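(* Consider the interconnected system described in the context, with a partition $\{1,\dots,n\}=I_\Sigma\cup I_{\max}$. Assume each subsystem is input-to-state stable (ISS) in the mixed sense, i.e. there exist $\beta_i\in\mathcal{KL}$ and $\gamma_{ij},\gamma_i\in\mathcal{K}_\infty\cup\{0\}$ (with $\gamma_{ii}\equiv0$) such that for all initial values $x_i(0)$ and inputs the unique solution $x_i$ satisfies for all $t\ge0$ $|x_i(t)|\le\beta_i(|x_i(0)|,t)+\sum_{j=1}^n\gamma_{ij}(\|x_{j[0,t]}\|_\infty)+\gamma_i(\|u\|_\infty)$ if $i\in I_\Sigma$, and $|x_i(t)|\le\max\{\beta_i(|x_i(0)|,t),\max_j\gamma_{ij}(\|x_{j[0,t]}\|_\infty),\gamma_i(\|u\|_\infty)\}$ if $i\in I_{\max}$. Let $\Gamma$ be the gain operator built from $(\gamma_{ij})$. If there exists $\alpha\in\mathcal{K}_\infty$ such that $\Gamma\circ D_\alpha(s)\not\ge s$ for all $s\in\mathbb{R}^n_+\setminus\{0\}$, then the whole system $\dot x=f(x,u)$ is ISS: there exist $\beta\in\mathcal{KL}$ and $\gamma\in\mathcal{K}$ with $|x(t)|\le\beta(|x(0)|,t)+\gamma(\|u\|_\infty)$ for all $x(0)$, all $u\in L_\infty$, all $t\ge0$.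
   Context: The interconnection is $\dot x_i=f_i(x_1,\dots,x_n,u_i)$, $i=1,\dots,n$, with $x_i\in\mathbb{R}^{N_i}$, $u_i\in\mathbb{R}^{m_i}$, where each $f_i$ is continuous and, for every $r$, locally Lipschitz in $x=(x_1^T,\dots,x_n^T)^T$ uniformly in $u_i$ with $|u_i|\le r$; it is written as $\dot x=f(x,u)$ with $u=(u_1^T,\dots,u_n^T)^T$. For the $i$-th subsystem the states $x_j$, $j\ne i$, are treated as independent inputs. $v_{[s_1,s_2]}$ equals $v$ on $[s_1,s_2]$ and $0$ elsewhere; $\|\cdot\|_\infty$ is the essential supremum norm. $\mathcal{K}$: continuous strictly increasing functions $\mathbb{R}_+\to\mathbb{R}_+$ vanishing at $0$; $\mathcal{K}_\infty$: unbounded ones; $\mathcal{KL}$: $\beta(\cdot,t)\in\mathcal{K}$ for each $t$ and $\beta(s,\cdot)$ nonincreasing with limit $0$. For $x,y\in\mathbb{R}^n$, $x\not\ge y$ means $x_i<y_i$ for some $i$. $\Gamma(s)=(\Gamma_1(s),\dots,\Gamma_n(s))^T$ with $\Gamma_i(s)=\sum_j\gamma_{ij}(s_j)$ for $i\in I_\Sigma$ and $\Gamma_i(s)=\max_j\gamma_{ij}(s_j)$ for $i\in I_{\max}$; $D_\alpha(s)=(D_1(s_1),\dots,D_n(s_n))^T$ with $D_i=\mathrm{id}+\alpha$ for $i\in I_\Sigma$ and $D_i=\mathrm{id}$ for $i\in I_{\max}$. *)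

theory Defs
  imports "HOL-Analysis.Analysis" "HOL-Probability.Essential_Supremum"
begin

definition classK :: "(real \<Rightarrow> real) \<Rightarrow> bool" where
  "classK g \<longleftrightarrow> continuous_on {0..} g \<and> strict_mono_on {0..} g \<and> g 0 = 0"

definition classKinf :: "(real \<Rightarrow> real) \<Rightarrow> bool" where
  "classKinf g \<longleftrightarrow> classK g \<and> (\<forall>M. \<exists>s\<ge>0. g s > M)"

definition classKinf0 :: "(real \<Rightarrow> real) \<Rightarrow> bool" where
  "classKinf0 g \<longleftrightarrow> classKinf g \<or> (\<forall>s\<ge>0. g s = 0)"

definition classKL :: "(real \<Rightarrow> real \<Rightarrow> real) \<Rightarrow> bool" where
  "classKL \<beta> \<longleftrightarrow>
     (\<forall>t\<ge>0. classK (\<lambda>s. \<beta> s t)) \<and>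
     (\<forall>s\<ge>0. (\<forall>t1 t2. 0 \<le> t1 \<and> t1 \<le> t2 \<longrightarrow> \<beta> s t2 \<le> \<beta> s t1) \<and> ((\<beta> s) \<longlongrightarrow> 0) at_top)"

text \<open>The essential supremum norm of a nonnegative real function on [0,oo)
  (w.r.t. Lebesgue measure); only used for functions in L_infinity.\<close>
definition linf_norm :: "(real \<Rightarrow> real) \<Rightarrow> real" where
  "linf_norm g = real_of_ereal (esssup (lebesgue_on {0..}) (\<lambda>t. ereal (g t)))"

definition is_Linf :: "(real \<Rightarrow> 'a::euclidean_space) \<Rightarrow> bool" where
  "is_Linf v \<longleftrightarrow> v \<in> borel_measurable (lebesgue_on {0..}) \<and>
     esssup (lebesgue_on {0..}) (\<lambda>t. ereal (norm (v t))) < \<infinity>"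

definition trunc :: "real \<Rightarrow> (real \<Rightarrow> real) \<Rightarrow> real \<Rightarrow> real" where
  "trunc t g = (\<lambda>s. if s \<in> {0..t} then g s else 0)"

text \<open>The state space R^N (N = N_1 + ... + N_n) is modelled by real^'d; the map
  blk assigns to every coordinate the index i of the subsystem it belongs to.
  x_i is the projection onto block i (embedded in real^'d, other coordinates 0),
  so that its Euclidean norm is the Euclidean norm |x_i| in R^(N_i).\<close>
definition bproj :: "('d \<Rightarrow> nat) \<Rightarrow> nat \<Rightarrow> real^'d \<Rightarrow> real^'d" where
  "bproj blk i v = (\<chi> k. if blk k = i then v $ k else 0)"

section \<open>Solutions (Caratheodory sense, written in integral form)\<close>

definition solves_on :: "(real^'d \<Rightarrow> real^'m \<Rightarrow> real^'d) \<Rightarrow> 'd set \<Rightarrow>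
    (real \<Rightarrow> real^'d) \<Rightarrow> (real \<Rightarrow> real^'m) \<Rightarrow> bool" where
  "solves_on f S z u \<longleftrightarrow>
     (\<forall>t\<ge>0. \<forall>k\<in>S. ((\<lambda>s. f (z s) (u s) $ k) has_integral (z t $ k - z 0 $ k)) {0..t})"

definition Gamma_op :: "nat \<Rightarrow> nat set \<Rightarrow> (nat \<Rightarrow> nat \<Rightarrow> real \<Rightarrow> real) \<Rightarrow>
    (nat \<Rightarrow> real) \<Rightarrow> nat \<Rightarrow> real" where
  "Gamma_op n Isig \<gamma> s i =
     (if i \<in> Isig then (\<Sum>j<n. \<gamma> i j (s j)) else Max ((\<lambda>j. \<gamma> i j (s j)) ` {..<n}))"

definition D_op :: "nat set \<Rightarrow> (real \<Rightarrow> real) \<Rightarrow> (nat \<Rightarrow> real) \<Rightarrow> nat \<Rightarrow> real" where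
  "D_op Isig \<alpha> s i = (if i \<in> Isig then s i + \<alpha> (s i) else s i)"

end

theory Submission
  imports Defs
begin

text \<open>
  Rewriting the small-gain condition as \<open>D \<circ> \<Gamma> \<not>\<ge> id\<close> yields a gain \<open>\<phi>\<close> such that every
  \<open>w \<ge> 0\<close> with \<open>w \<le> \<Gamma> w\<close> perturbed by \<open>b\<close> satisfies \<open>w \<le> \<phi> b\<close>: one component of \<open>w\<close> is bounded
  directly; after setting the bounded components to zero and absorbing them into \<open>b\<close>, the condition
  bounds a further component. Applied to the suprema of the blocks on \<open>[0,T]\<close> this bounds solutions
  independently of \<open>T\<close>, so a solution of the system with the state projected to a large ball never
  leaves that ball, which gives global existence. Applied to the limits, as \<open>T \<longrightarrow> \<infinity>\<close>, of the
  suprema over all times \<open>t \<ge> T\<close> and all trajectories with prescribed bounds on initial value and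
  input, it gives uniform attraction to a ball whose radius is a gain of the input norm. Boundedness
  and uniform attraction are then combined into a \<open>\<K>\<L>\<close> estimate.
\<close>

section \<open>Gains and the small-gain comparison principle\<close>

text \<open>The small-gain condition speaks only about finite vectors, so suprema over all times
  cannot be used at the outset. Continuity makes the suprema finite on each \<open>[0,T]\<close>,
  and since the resulting bound does not involve \<open>T\<close>, suprema over the half-line become
  available afterwards. The attraction argument needs a further precaution: a limit superior along
  each single trajectory would obey a similar inequality, but the time needed to come close to it
  could vary with the trajectory, whereas a class KL bound calls for one time per size of the
  initial value. Taking suprema over whole families of trajectories before time tends to infinity is
  what makes the attraction time uniform.\<close>

definition gain :: "(real \<Rightarrow> real) \<Rightarrow> bool" where
  "gain g \<longleftrightarrow> continuous_on {0..} g \<and> mono_on {0..} g \<and> g 0 = 0"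

lemma gain_mono: "gain g \<Longrightarrow> 0 \<le> x \<Longrightarrow> x \<le> y \<Longrightarrow> g x \<le> g y"
  by (auto simp: gain_def mono_on_def)

lemma gain_nonneg: "gain g \<Longrightarrow> 0 \<le> x \<Longrightarrow> 0 \<le> g x"
  using gain_mono[of g 0 x] by (simp add: gain_def)

lemma gain_zero: "gain g \<Longrightarrow> g 0 = 0"
  by (simp add: gain_def)

lemma gain_tendsto:
  assumes "gain g" "(h \<longlongrightarrow> l) F" "0 \<le> l" "\<And>x. 0 \<le> h x"
  shows "((\<lambda>x. g (h x)) \<longlongrightarrow> g l) F"
  using assms by (intro continuous_on_tendsto_compose[of "{0..}" g h l F]) (auto simp: gain_def)

lemma classK_gain: "classK g \<Longrightarrow> gain g"
  by (auto simp: classK_def gain_def intro: strict_mono_on_imp_mono_on)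

lemma classKinf0_gain: "classKinf0 g \<Longrightarrow> gain g"
proof -
  assume "classKinf0 g"
  then consider "classK g" | "\<forall>s\<ge>0. g s = 0"
    by (auto simp: classKinf0_def classKinf_def)
  then show ?thesis
  proof cases
    case 2
    then have "continuous_on {0..} g"
      by (subst continuous_on_cong[OF refl, of _ _ "\<lambda>_. 0"]) auto
    with 2 show ?thesis by (auto simp: gain_def mono_on_def)
  qed (rule classK_gain)
qed

lemma gain_id: "gain (\<lambda>x. x)"
  by (auto simp: gain_def mono_on_def)

lemma gain_add: "gain f \<Longrightarrow> gain g \<Longrightarrow> gain (\<lambda>x. f x + g x)"
  unfolding gain_def mono_on_def by (auto intro!: continuous_on_add add_mono)

lemma gain_cmult: "gain g \<Longrightarrow> 0 \<le> c \<Longrightarrow> gain (\<lambda>x. c * g x)"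
  unfolding gain_def mono_on_def
  by (auto intro!: continuous_on_mult continuous_on_const simp: mult_left_mono)

lemma gain_sum: "(\<And>i. i \<in> I \<Longrightarrow> gain (g i)) \<Longrightarrow> gain (\<lambda>x. \<Sum>i\<in>I. g i x)"
  unfolding gain_def mono_on_def
  by (auto intro!: continuous_on_sum sum_mono)

lemma gain_compose:
  assumes "gain f" "gain g"
  shows "gain (\<lambda>x. f (g x))"
proof -
  have "g ` {0..} \<subseteq> {0..}"
    using gain_nonneg[OF assms(2)] by auto
  moreover have "continuous_on {0..} f" "continuous_on {0..} g"
    using assms by (simp_all add: gain_def)
  ultimately have "continuous_on {0..} (\<lambda>x. f (g x))"
    by (intro continuous_on_compose2[of "{0..}" f "{0..}" g])
  moreover have "mono_on {0..} (\<lambda>x. f (g x))"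
    by (intro mono_onI gain_mono[OF assms(1)] gain_mono[OF assms(2)] gain_nonneg[OF assms(2)]) auto
  ultimately show ?thesis
    by (simp add: gain_def gain_zero[OF assms(1)] gain_zero[OF assms(2)])
qed

text \<open>Gains are only weakly increasing, so that zero gains are included and sums and
  compositions stay inside the class. Adding the identity restores strictness where class K is
  demanded.\<close>

lemma classK_gain_plus_id:
  assumes "gain g"
  shows "classK (\<lambda>x. g x + x)"
proof -
  have "continuous_on {0..} (\<lambda>x. g x + x)"
    using assms by (intro continuous_on_add continuous_on_id) (simp add: gain_def)
  moreover have "strict_mono_on {0..} (\<lambda>x. g x + x)"
    by (intro strict_mono_onI add_le_less_mono gain_mono[OF assms]) auto
  ultimately show ?thesis
    by (simp add: classK_def gain_zero[OF assms])
qed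

lemma classKinf_surj:
  assumes "classKinf a" "0 \<le> y"
  shows "\<exists>x\<ge>0. a x = y"
proof -
  obtain s where s: "s \<ge> 0" "a s > y"
    using assms by (auto simp: classKinf_def)
  have "continuous_on {0..s} a"
    using assms by (auto simp: classKinf_def classK_def intro: continuous_on_subset)
  then show ?thesis
    using IVT'[of a 0 y s] s assms by (auto simp: classKinf_def classK_def)
qed

lemma classKinf_inverse:
  assumes a: "classKinf a"
  shows "\<exists>h. gain h \<and> (\<forall>y\<ge>0. a (h y) = y)"
proof -
  have sm: "x < y \<Longrightarrow> 0 \<le> x \<Longrightarrow> a x < a y" for x y
    using a by (auto simp: classKinf_def classK_def strict_mono_on_def)
  have a0: "a 0 = 0" using a by (auto simp: classKinf_def classK_def)
  \<comment> \<open>Extended by the identity to negative arguments, \<open>a\<close> becomes a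
    strictly increasing bijection of the line. Its inverse is monotone with full range, and this
    forces continuity.\<close>
  define e where "e x = (if x < 0 then x else a x)" for x
  have e_mono: "strict_mono e"
  proof (rule strict_monoI)
    fix x y :: real assume "x < y"
    then show "e x < e y"
      using sm[of x y] sm[of 0 y] a0 by (cases "y = 0") (auto simp: e_def)
  qed
  have e_surj: "\<exists>x. e x = y" for y
  proof (cases "y < 0")
    case True
    then show ?thesis by (intro exI[of _ y]) (simp add: e_def)
  next
    case False
    then obtain x where "x \<ge> 0" "a x = y" using classKinf_surj[OF a, of y] by auto
    then show ?thesis by (intro exI[of _ x]) (simp add: e_def)
  qed
  define h where "h = inv e"
  have eh: "e (h y) = y" for y
    unfolding h_def using e_surj[of y] by (metis f_inv_into_f rangeI)
  have he: "h (e x) = x" for x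
    unfolding h_def using e_mono by (simp add: strict_mono_imp_inj_on)
  have h_mono: "x \<le> y \<Longrightarrow> h x \<le> h y" for x y
    using strict_mono_less_eq[OF e_mono] eh by metis
  have "range h = UNIV"
    using he by (metis surjI)
  then have "continuous_on UNIV h"
    by (intro continuous_onI_mono) (auto intro: h_mono)
  moreover have h0: "h 0 = 0"
    using he[of 0] by (simp add: e_def a0)
  moreover have "a (h y) = y" if "y \<ge> 0" for y
    using eh[of y] h_mono[of 0 y] h0 that by (auto simp: e_def)
  ultimately show ?thesis
    by (intro exI[of _ h]) (auto simp: gain_def mono_on_def intro: h_mono continuous_on_subset)
qed

text \<open>\<open>b\<close> collects the initial-value and input terms and enters each row in the
  way the gains do there. The form matters: \<open>D_op\<close> has no margin in the max rows, so a
  perturbation added there could not be absorbed.\<close>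

definition mixed_op :: "nat \<Rightarrow> nat set \<Rightarrow> (nat \<Rightarrow> nat \<Rightarrow> real \<Rightarrow> real) \<Rightarrow> real \<Rightarrow>
    (nat \<Rightarrow> real) \<Rightarrow> nat \<Rightarrow> real" where
  "mixed_op n Isig \<gamma> b s i =
     (if i \<in> Isig then Gamma_op n Isig \<gamma> s i + b else max (Gamma_op n Isig \<gamma> s i) b)"

lemma Gamma_op_nonneg:
  assumes "\<And>j. j < n \<Longrightarrow> gain (\<gamma> i j)" "\<And>j. j < n \<Longrightarrow> 0 \<le> s j" "i < n"
  shows "0 \<le> Gamma_op n Isig \<gamma> s i"
proof -
  have nn: "0 \<le> \<gamma> i j (s j)" if "j < n" for j
    using gain_nonneg[OF assms(1)[OF that] assms(2)[OF that]] .
  show ?thesis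
  proof (cases "i \<in> Isig")
    case True
    then show ?thesis using nn by (auto simp: Gamma_op_def intro!: sum_nonneg)
  next
    case False
    have "0 \<le> \<gamma> i i (s i)" using nn assms(3) .
    also have "\<dots> \<le> Max ((\<lambda>j. \<gamma> i j (s j)) ` {..<n})" using assms(3) by (intro Max_ge) auto
    finally show ?thesis using False by (simp add: Gamma_op_def)
  qed
qed

text \<open>By the intermediate value theorem \<open>D_op Isig \<alpha>\<close> maps the orthant
  onto itself, so \<open>w\<close> is the image of some \<open>s\<close>. The condition at
  \<open>s\<close> then compares the Gamma image of \<open>w\<close> with \<open>s\<close>, and
  applying the increasing component of \<open>D_op\<close> to both sides gives the claim.\<close>

lemma small_gain_DGamma:
  assumes "classKinf \<alpha>" and g: "\<And>i j. i < n \<Longrightarrow> j < n \<Longrightarrow> gain (\<gamma> i j)"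
    and sg: "\<forall>s. (\<forall>i<n. 0 \<le> s i) \<and> (\<exists>i<n. s i \<noteq> 0) \<longrightarrow>
           (\<exists>i<n. Gamma_op n Isig \<gamma> (D_op Isig \<alpha> s) i < s i)"
    and w: "\<And>i. i < n \<Longrightarrow> 0 \<le> w i" "\<exists>i<n. w i \<noteq> 0"
  shows "\<exists>i<n. D_op Isig \<alpha> (Gamma_op n Isig \<gamma> w) i < w i"
proof -
  have am: "classK \<alpha>" using assms by (simp add: classKinf_def)
  have aux: "\<exists>s\<ge>0. s + \<alpha> s = y" if "0 \<le> y" for y
  proof -
    have ap: "0 \<le> \<alpha> y" by (rule gain_nonneg[OF classK_gain[OF am] that])
    have "continuous_on {0..y} (\<lambda>s. s + \<alpha> s)"
      using am by (auto simp: classK_def intro!: continuous_intros intro: continuous_on_subset)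
    then show ?thesis
      using IVT'[of "\<lambda>s. s + \<alpha> s" 0 y y] am that ap by (auto simp: classK_def)
  qed
  have "\<exists>s\<ge>0. (if i \<in> Isig then s + \<alpha> s else s) = w i" if "i < n" for i
    using aux[of "w i"] w that by auto
  then obtain s where s: "\<And>i. i < n \<Longrightarrow> 0 \<le> s i"
    "\<And>i. i < n \<Longrightarrow> (if i \<in> Isig then s i + \<alpha> (s i) else s i) = w i"
    by metis
  have Ds: "D_op Isig \<alpha> s i = w i" if "i < n" for i
    using s(2)[OF that] by (simp add: D_op_def)
  obtain k where "k < n" "w k \<noteq> 0" using w(2) by blast
  then have "\<exists>i<n. s i \<noteq> 0"
    using s(2)[of k] am by (intro exI[of _ k]) (auto simp: classK_def split: if_splits)
  then obtain i where i: "i < n" "Gamma_op n Isig \<gamma> (D_op Isig \<alpha> s) i < s i"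
    using sg s(1) by blast
  have eq: "Gamma_op n Isig \<gamma> (D_op Isig \<alpha> s) i = Gamma_op n Isig \<gamma> w i"
    using Ds by (auto simp: Gamma_op_def intro!: sum.cong arg_cong[where f=Max] image_cong)
  have "0 \<le> Gamma_op n Isig \<gamma> w i"
    by (rule Gamma_op_nonneg) (use g w i in auto)
  then have "\<alpha> (Gamma_op n Isig \<gamma> w i) < \<alpha> (s i)"
    using am i eq by (auto simp: classK_def strict_mono_on_def)
  then have "D_op Isig \<alpha> (Gamma_op n Isig \<gamma> w) i < w i"
    using i eq s(2)[OF i(1)] by (auto simp: D_op_def split: if_splits)
  with i show ?thesis by blast
qed

text \<open>The double sum of all gains at \<open>c\<close> dominates what the components in
  \<open>J\<close> contribute to any row, whether the row adds or maximizes, so one number serves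
  all rows.\<close>

lemma mixed_op_restrict:
  assumes g: "\<And>i j. i < n \<Longrightarrow> j < n \<Longrightarrow> gain (\<gamma> i j)"
    and w: "\<And>i. i < n \<Longrightarrow> 0 \<le> w i" and c: "\<And>j. j \<in> J \<Longrightarrow> j < n \<Longrightarrow> w j \<le> c" and "0 \<le> c"
    and "i < n" "0 \<le> b"
  shows "mixed_op n Isig \<gamma> b w i \<le>
    mixed_op n Isig \<gamma> (b + (\<Sum>i<n. \<Sum>j<n. \<gamma> i j c)) (\<lambda>j. if j \<in> J then 0 else w j) i"
proof -
  let ?w = "\<lambda>j. if j \<in> J then 0 else w j" and ?C = "\<Sum>i<n. \<Sum>j<n. \<gamma> i j c"
  have cn: "0 \<le> \<gamma> i j c" if "i < n" "j < n" for i j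
    using gain_nonneg[OF g[OF that] \<open>0 \<le> c\<close>] .
  have wn: "0 \<le> \<gamma> i j (w j)" if "j < n" for j
    using gain_nonneg[OF g[OF \<open>i < n\<close> that] w[OF that]] .
  have wc: "\<gamma> i j (w j) \<le> \<gamma> i j c" if "j \<in> J" "j < n" for j
    using gain_mono[OF g[OF \<open>i < n\<close> that(2)] w[OF that(2)] c[OF that]] .
  have row: "(\<Sum>j<n. \<gamma> i j c) \<le> ?C"
    using \<open>i < n\<close> cn by (intro member_le_sum) (auto intro!: sum_nonneg)
  show ?thesis
  proof (cases "i \<in> Isig")
    case True
    have "(\<Sum>j<n. \<gamma> i j (w j)) \<le> (\<Sum>j<n. \<gamma> i j (?w j) + \<gamma> i j c)"
      using wc cn[OF \<open>i < n\<close>] gain_zero[OF g[OF \<open>i < n\<close>]] by (intro sum_mono) auto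
    then show ?thesis using True row
      by (simp add: mixed_op_def Gamma_op_def sum.distrib)
  next
    case False
    have "\<gamma> i j (w j) \<le> max (Max ((\<lambda>j. \<gamma> i j (?w j)) ` {..<n})) (b + ?C)" if j: "j < n" for j
    proof (cases "j \<in> J")
      case True
      have "\<gamma> i j (w j) \<le> \<gamma> i j c"
        using wc[OF True j] .
      also have "\<gamma> i j c \<le> (\<Sum>j<n. \<gamma> i j c)"
        using j cn[OF \<open>i < n\<close>] by (intro member_le_sum) auto
      finally show ?thesis using row \<open>0 \<le> b\<close> by simp
    next
      case False
      have "\<gamma> i j (?w j) \<le> Max ((\<lambda>j. \<gamma> i j (?w j)) ` {..<n})"
        using j by (intro Max_ge) auto
      with False show ?thesis by simp
    qed
    then have "Max ((\<lambda>j. \<gamma> i j (w j)) ` {..<n})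
        \<le> max (Max ((\<lambda>j. \<gamma> i j (?w j)) ` {..<n})) (b + ?C)"
      using \<open>i < n\<close> by (intro Max.boundedI) auto
    moreover have "0 \<le> ?C" using cn by (intro sum_nonneg) auto
    ultimately show ?thesis
      using False by (simp add: mixed_op_def Gamma_op_def)
  qed
qed

lemma small_gain_comparison:
  assumes a: "classKinf \<alpha>" and g: "\<And>i j. i < n \<Longrightarrow> j < n \<Longrightarrow> gain (\<gamma> i j)"
    and sg: "\<forall>s. (\<forall>i<n. 0 \<le> s i) \<and> (\<exists>i<n. s i \<noteq> 0) \<longrightarrow>
           (\<exists>i<n. Gamma_op n Isig \<gamma> (D_op Isig \<alpha> s) i < s i)"
  shows "\<exists>\<phi>. gain \<phi> \<and> (\<forall>b w. 0 \<le> b \<and> (\<forall>i<n. 0 \<le> w i \<and> w i \<le> mixed_op n Isig \<gamma> b w i) \<longrightarrow>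
           (\<forall>i<n. w i \<le> \<phi> b))"
proof -
  obtain h where h: "gain h" "\<And>y. y \<ge> 0 \<Longrightarrow> \<alpha> (h y) = y"
    using classKinf_inverse[OF a] by blast
  have h_upper: "y \<le> h x" if "0 \<le> x" "\<alpha> y \<le> x" "0 \<le> y" for x y
  proof (rule ccontr)
    assume "\<not> y \<le> h x"
    then have "\<alpha> (h x) < \<alpha> y"
      using a gain_nonneg[OF h(1) that(1)] that by (auto simp: classKinf_def classK_def strict_mono_on_def)
    with h(2)[OF that(1)] that show False by simp
  qed
  \<comment> \<open>The induction counts the components already bounded. The gain \<open>c\<close>
    is chosen before \<open>b\<close> and \<open>w\<close>; only the index set \<open>J\<close>
    depends on them, because the component singled out by the condition varies with
    \<open>w\<close>.\<close>
  have "\<exists>c. gain c \<and> (\<forall>b w. 0 \<le> b \<and> (\<forall>i<n. 0 \<le> w i \<and> w i \<le> mixed_op n Isig \<gamma> b w i) \<longrightarrow>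
           (\<exists>J\<subseteq>{..<n}. card J = k \<and> (\<forall>j\<in>J. w j \<le> c b)))" if "k \<le> n" for k
    using that
  proof (induction k)
    case 0
    show ?case
      by (rule exI[of _ "\<lambda>x. x"]) (auto simp: gain_id intro!: exI[of _ "{}"])
  next
    case (Suc k)
    then obtain c where c: "gain c" and cJ:
      "\<And>b w. 0 \<le> b \<Longrightarrow> (\<forall>i<n. 0 \<le> w i \<and> w i \<le> mixed_op n Isig \<gamma> b w i) \<Longrightarrow>
           (\<exists>J\<subseteq>{..<n}. card J = k \<and> (\<forall>j\<in>J. w j \<le> c b))"
      by auto
    define b' where "b' b = b + (\<Sum>i<n. \<Sum>j<n. \<gamma> i j (c b))" for b
    \<comment> \<open>\<open>c b\<close> keeps the old members of \<open>J\<close> bounded,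
      \<open>b' b\<close> suffices for a new max row, and \<open>h (b' b)\<close> bounds the Gamma
      part of a new sum row.\<close>
    define c' where "c' b = c b + (b' b + h (b' b))" for b
    have gb': "gain b'"
      unfolding b'_def by (intro gain_add gain_id gain_sum gain_compose[OF g c]) auto
    have gc': "gain c'"
      unfolding c'_def by (intro gain_add gb' c gain_compose[OF h(1) gb'])
    have "\<exists>J\<subseteq>{..<n}. card J = Suc k \<and> (\<forall>j\<in>J. w j \<le> c' b)"
      if b: "0 \<le> b" and w: "\<forall>i<n. 0 \<le> w i \<and> w i \<le> mixed_op n Isig \<gamma> b w i" for b w
    proof -
      obtain J where J: "J \<subseteq> {..<n}" "card J = k" "\<forall>j\<in>J. w j \<le> c b"
        using cJ[OF b w] by blast
      have nn: "0 \<le> c b" "0 \<le> b' b" "0 \<le> h (b' b)"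
        using gain_nonneg[OF c b] gain_nonneg[OF gb' b] gain_nonneg[OF h(1) gain_nonneg[OF gb' b]] by auto
      let ?w = "\<lambda>j. if j \<in> J then 0 else w j"
      have "\<exists>i<n. i \<notin> J \<and> w i \<le> c' b"
      proof (cases "\<exists>i<n. ?w i \<noteq> 0")
        case True
        obtain i where i: "i < n" "D_op Isig \<alpha> (Gamma_op n Isig \<gamma> ?w) i < ?w i"
          using small_gain_DGamma[OF a g sg, of ?w] w True by force
        have G0: "0 \<le> Gamma_op n Isig \<gamma> ?w i"
          by (rule Gamma_op_nonneg) (use g w i in auto)
        then have D0: "0 \<le> \<alpha> (Gamma_op n Isig \<gamma> ?w i)"
          using gain_nonneg[OF classK_gain] a by (auto simp: classKinf_def)
        \<comment> \<open>On \<open>J\<close> the modified vector is 0, which cannot exceed the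
          nonnegative left-hand side.\<close>
        have iJ: "i \<notin> J"
          using i G0 D0 by (auto simp: D_op_def split: if_splits)
        have "w i \<le> mixed_op n Isig \<gamma> b w i" using w i by auto
        also have "\<dots> \<le> mixed_op n Isig \<gamma> (b' b) ?w i"
          unfolding b'_def by (rule mixed_op_restrict) (use g w J nn b i in auto)
        finally have le: "w i \<le> mixed_op n Isig \<gamma> (b' b) ?w i" .
        \<comment> \<open>Let \<open>g\<close> be the Gamma part. In a sum row
          \<open>g + \<alpha> g < w i \<le> g + b' b\<close> bounds \<open>\<alpha> g\<close> and
          hence \<open>g\<close>; in a max row \<open>g < w i\<close> forces the maximum to be
          \<open>b' b\<close>.\<close>
        have "w i \<le> b' b + h (b' b)"
        proof (cases "i \<in> Isig")
          case True
          have "\<alpha> (Gamma_op n Isig \<gamma> ?w i) \<le> b' b"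
            using le i iJ True by (simp add: mixed_op_def D_op_def)
          then have "Gamma_op n Isig \<gamma> ?w i \<le> h (b' b)"
            using h_upper nn G0 by auto
          then show ?thesis using le True by (simp add: mixed_op_def)
        next
          case False
          then show ?thesis using le i iJ nn by (simp add: mixed_op_def D_op_def)
        qed
        then show ?thesis using i iJ nn by (auto simp: c'_def intro!: exI[of _ i])
      next
        case False
        \<comment> \<open>Here every component outside \<open>J\<close> vanishes, so any of them can
          be added.\<close>
        have "J \<noteq> {..<n}" using J Suc.prems by auto
        then obtain i where "i < n" "i \<notin> J" using J by auto
        with False nn show ?thesis by (auto simp: c'_def intro!: exI[of _ i])
      qed
      then obtain i where i: "i < n" "i \<notin> J" "w i \<le> c' b" by blast
      have "finite J" using J finite_subset by blast
      then show ?thesis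
        using J i nn by (intro exI[of _ "insert i J"]) (auto simp: c'_def)
    qed
    with gc' show ?case by blast
  qed
  from this[of n] obtain c where c: "gain c" and cJ:
      "\<And>b w. 0 \<le> b \<Longrightarrow> (\<forall>i<n. 0 \<le> w i \<and> w i \<le> mixed_op n Isig \<gamma> b w i) \<Longrightarrow>
           (\<exists>J\<subseteq>{..<n}. card J = n \<and> (\<forall>j\<in>J. w j \<le> c b))"
    by auto
  have "w i \<le> c b" if bw: "0 \<le> b" "\<forall>i<n. 0 \<le> w i \<and> w i \<le> mixed_op n Isig \<gamma> b w i" and "i < n" for b w i
  proof -
    obtain J where "J \<subseteq> {..<n}" "card J = n" "\<forall>j\<in>J. w j \<le> c b"
      using cJ[OF bw] by blast
    moreover from this have "J = {..<n}" by (intro card_subset_eq) auto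
    ultimately show ?thesis using \<open>i < n\<close> by auto
  qed
  with c show ?thesis by blast
qed

section \<open>Essentially bounded inputs and solutions on intervals\<close>

text \<open>The essential supremum of a constant is that constant only over a space of positive
  measure; nonnegativity of essential suprema below rests on this.\<close>

lemma emeasure_halfline_ne_0: "emeasure (lebesgue_on {0::real..}) (space (lebesgue_on {0..})) \<noteq> 0"
proof -
  have "emeasure (lebesgue_on {0::real..}) {0..1} \<le> emeasure (lebesgue_on {0::real..}) (space (lebesgue_on {0..}))"
    by (intro emeasure_mono) (auto simp: sets_restrict_space_iff)
  moreover have "emeasure (lebesgue_on {0::real..}) {0..1} = 1"
    by (subst emeasure_restrict_space) auto
  ultimately show ?thesis by auto
qed

lemma esssup_halfline_nonneg:
  fixes g :: "real \<Rightarrow> real"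
  assumes "\<And>t. 0 \<le> g t"
  shows "0 \<le> esssup (lebesgue_on {0..}) (\<lambda>t. ereal (g t))"
proof -
  have "esssup (lebesgue_on {0..}) (\<lambda>t::real. 0::ereal) \<le> esssup (lebesgue_on {0..}) (\<lambda>t. ereal (g t))"
    using assms by (intro esssup_mono) auto
  then show ?thesis
    by (simp only: esssup_const[OF emeasure_halfline_ne_0])
qed

lemma linf_norm_nonneg: "(\<And>t. 0 \<le> g t) \<Longrightarrow> 0 \<le> linf_norm g"
  unfolding linf_norm_def using esssup_halfline_nonneg by (intro real_of_ereal_pos) auto

lemma linf_norm_AE_le:
  assumes "\<And>t. 0 \<le> g t" "0 \<le> M" "AE t in lebesgue_on {0..}. g t \<le> M"
  shows "linf_norm g \<le> M"
proof (cases "(\<lambda>t. ereal (g t)) \<in> borel_measurable (lebesgue_on {0..})")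
  case True
  have "esssup (lebesgue_on {0..}) (\<lambda>t. ereal (g t)) \<le> ereal M"
    using True assms(3) by (intro esssup_I) auto
  then show ?thesis
    unfolding linf_norm_def using esssup_halfline_nonneg[of g] assms(1,2)
    by (cases "esssup (lebesgue_on {0..}) (\<lambda>t. ereal (g t))") auto
next
  \<comment> \<open>Without measurability the essential supremum is infinite, and
    \<open>real_of_ereal\<close> sends infinity to 0.\<close>
  case False
  then show ?thesis
    unfolding linf_norm_def using assms(2) by (simp add: esssup_non_measurable top_ereal_def)
qed

lemma linf_norm_le:
  assumes "\<And>t. 0 \<le> g t" "0 \<le> M" "\<And>t. 0 \<le> t \<Longrightarrow> g t \<le> M"
  shows "linf_norm g \<le> M"
  using assms by (intro linf_norm_AE_le) (auto intro!: AE_I2)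

text \<open>Finiteness matters here: for an infinite essential supremum \<open>linf_norm\<close>
  takes the default value 0 and bounds nothing.\<close>

lemma is_Linf_AE:
  assumes "is_Linf u"
  shows "AE t in lebesgue_on {0..}. norm (u t) \<le> linf_norm (\<lambda>t. norm (u t))"
proof -
  let ?E = "esssup (lebesgue_on {0..}) (\<lambda>t. ereal (norm (u t)))"
  have "?E < \<infinity>" "0 \<le> ?E" using assms esssup_halfline_nonneg[of "\<lambda>t. norm (u t)"] by (auto simp: is_Linf_def)
  then have "?E = ereal (linf_norm (\<lambda>t. norm (u t)))"
    unfolding linf_norm_def by (cases ?E) auto
  then show ?thesis
    using esssup_AE[of "\<lambda>t. ereal (norm (u t))" "lebesgue_on {0..}"] by simp
qed

lemma is_LinfI:
  assumes "v \<in> borel_measurable (lebesgue_on {0..})" "AE t in lebesgue_on {0..}. norm (v t) \<le> M"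
  shows "is_Linf v"
proof -
  have "esssup (lebesgue_on {0..}) (\<lambda>t. ereal (norm (v t))) \<le> ereal M"
    using assms by (intro esssup_I) auto
  then show ?thesis using assms(1) by (auto simp: is_Linf_def intro: le_less_trans)
qed

section \<open>Time shifts of inputs\<close>

lemma lebesgue_on_halfline_shift_measurable:
  assumes "0 \<le> (s::real)"
  shows "(\<lambda>t. t + s) \<in> measurable (lebesgue_on {0..}) (lebesgue_on {0..})"
proof (rule measurable_restrict_space3)
  show "(\<lambda>t. t + s) \<in> lebesgue \<rightarrow>\<^sub>M lebesgue"
    using lebesgue_affine_measurable[of "\<lambda>_. 1" s] by (simp add: add.commute)
qed (use assms in auto)

lemma AE_halfline_shift:
  assumes "0 \<le> (s::real)" "AE t in lebesgue_on {0..}. P t"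
  shows "AE t in lebesgue_on {0..}. P (t + s)"
proof -
  have "AE t in lebesgue. t \<in> {0..} \<longrightarrow> P t"
    using assms(2) by (subst (asm) AE_restrict_space_iff) auto
  then obtain N where N: "negligible N" "{t. \<not> (t \<in> {0..} \<longrightarrow> P t)} \<subseteq> N"
    by (auto simp: eventually_ae_filter_negligible)
  have "negligible ((+) (-s) ` N)" using N(1) by (rule negligible_translation)
  moreover have "{t. \<not> (t \<in> {0..} \<longrightarrow> P (t + s))} \<subseteq> (+) (-s) ` N"
  proof
    fix t assume "t \<in> {t. \<not> (t \<in> {0..} \<longrightarrow> P (t + s))}"
    then have "t + s \<in> N" using N(2) assms(1) by auto
    then show "t \<in> (+) (-s) ` N" by (intro image_eqI[of _ _ "t + s"]) auto
  qed
  ultimately have "AE t in lebesgue. t \<in> {0..} \<longrightarrow> P (t + s)"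
    unfolding eventually_ae_filter_negligible by blast
  then show ?thesis by (subst AE_restrict_space_iff) auto
qed

lemma is_Linf_shift:
  assumes "is_Linf u" "0 \<le> s"
  shows "is_Linf (\<lambda>t. u (t + s))"
    and "linf_norm (\<lambda>t. norm (u (t + s))) \<le> linf_norm (\<lambda>t. norm (u t))"
proof -
  have AE: "AE t in lebesgue_on {0..}. norm (u (t + s)) \<le> linf_norm (\<lambda>t. norm (u t))"
    by (rule AE_halfline_shift[OF assms(2) is_Linf_AE[OF assms(1)]])
  have "(\<lambda>t. u (t + s)) \<in> borel_measurable (lebesgue_on {0..})"
    using measurable_compose[OF lebesgue_on_halfline_shift_measurable[OF assms(2)]] assms(1)
    by (auto simp: is_Linf_def)
  then show "is_Linf (\<lambda>t. u (t + s))" using AE by (rule is_LinfI)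
  show "linf_norm (\<lambda>t. norm (u (t + s))) \<le> linf_norm (\<lambda>t. norm (u t))"
    using AE by (intro linf_norm_AE_le linf_norm_nonneg) auto
qed

lemma is_Linf_continuous:
  fixes v :: "real \<Rightarrow> 'a::euclidean_space"
  assumes "continuous_on {0..} v" "\<And>t. 0 \<le> t \<Longrightarrow> norm (v t) \<le> M"
  shows "is_Linf v"
proof (rule is_LinfI)
  show "v \<in> borel_measurable (lebesgue_on {0..})"
    using assms(1) by (intro continuous_imp_measurable_on_sets_lebesgue) auto
  show "AE t in lebesgue_on {0..}. norm (v t) \<le> M"
    using assms(2) by (auto intro!: AE_I2)
qed

section \<open>Solutions on finite intervals, their shifts and gluings\<close>

definition solves_upto :: "(real^'d \<Rightarrow> real^'m \<Rightarrow> real^'d) \<Rightarrow> 'd set \<Rightarrow> real \<Rightarrow>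
    (real \<Rightarrow> real^'d) \<Rightarrow> (real \<Rightarrow> real^'m) \<Rightarrow> bool" where
  "solves_upto f S T z u \<longleftrightarrow>
     (\<forall>t\<in>{0..T}. \<forall>k\<in>S. ((\<lambda>s. f (z s) (u s) $ k) has_integral (z t $ k - z 0 $ k)) {0..t})"

lemma solves_on_imp_upto: "solves_on f S z u \<Longrightarrow> solves_upto f S T z u"
  by (auto simp: solves_on_def solves_upto_def)

lemma solves_upto_mono: "solves_upto f S T z u \<Longrightarrow> T' \<le> T \<Longrightarrow> S' \<subseteq> S \<Longrightarrow> solves_upto f S' T' z u"
  by (auto simp: solves_upto_def)

lemma solves_upto_continuous:
  assumes "solves_upto f UNIV T z u"
  shows "continuous_on {0..T} z"
proof (cases "0 \<le> T")
  case True
  have "continuous_on {0..T} (\<lambda>t. z t $ k)" for k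
  proof -
    let ?g = "\<lambda>s. f (z s) (u s) $ k"
    have hi: "(?g has_integral (z t $ k - z 0 $ k)) {0..t}" if "t \<in> {0..T}" for t
      using assms that by (auto simp: solves_upto_def)
    have "?g integrable_on {0..T}" using hi[of T] True by auto
    then have "continuous_on {0..T} (\<lambda>t. integral {0..t} ?g + z 0 $ k)"
      by (intro continuous_intros indefinite_integral_continuous_1)
    moreover have "integral {0..t} ?g + z 0 $ k = z t $ k" if "t \<in> {0..T}" for t
      using integral_unique[OF hi[OF that]] by simp
    ultimately show ?thesis by (subst (asm) continuous_on_cong[OF refl]) auto
  qed
  then have "continuous_on {0..T} (\<lambda>t. \<chi> k. z t $ k)"
    by (rule continuous_on_vec_lambda)
  then show ?thesis by simp
qed simp

lemma solves_on_shift: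
  assumes "solves_on f S z u" "0 \<le> s"
  shows "solves_on f S (\<lambda>t. z (t + s)) (\<lambda>t. u (t + s))"
  unfolding solves_on_def
proof (intro allI impI ballI)
  fix t k assume t: "0 \<le> (t::real)" and k: "k \<in> S"
  let ?g = "\<lambda>s. f (z s) (u s) $ k"
  have hi: "(?g has_integral (z t $ k - z 0 $ k)) {0..t}" if "0 \<le> t" for t
    using assms that k by (auto simp: solves_on_def)
  have i: "?g integrable_on {0..t + s}" using hi[of "t + s"] t assms by auto
  then have "?g integrable_on {s..t+s}"
    by (rule integrable_on_subinterval) (use assms t in auto)
  moreover have "integral {0..s} ?g + integral {s..t+s} ?g = integral {0..t+s} ?g"
    by (rule Henstock_Kurzweil_Integration.integral_combine) (use assms t i in auto)
  ultimately have "(?g has_integral (z (t + s) $ k - z s $ k)) {s..t+s}"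
    using integral_unique[OF hi[of s]] integral_unique[OF hi[of "t + s"]] assms t
    by (simp add: has_integral_iff)
  from has_integral_shift_real_ivl[OF this, of s]
  show "((\<lambda>x. f (z (x + s)) (u (x + s)) $ k) has_integral z (t + s) $ k - z (0 + s) $ k) {0..t}"
    by simp
qed

lemma solves_on_glue:
  assumes z: "solves_upto f S T z u" and y: "solves_on f S y (\<lambda>t. u (t + T))"
    and "0 \<le> T" "y 0 = z T"
  shows "solves_on f S (\<lambda>t. if t \<le> T then z t else y (t - T)) u"
  unfolding solves_on_def
proof (intro allI impI ballI)
  fix t k assume t: "0 \<le> (t::real)" and k: "k \<in> S"
  let ?Z = "\<lambda>t. if t \<le> T then z t else y (t - T)"
  have before: "((\<lambda>s. f (?Z s) (u s) $ k) has_integral z t $ k - z 0 $ k) {0..t}" if "t \<in> {0..T}" for t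
  proof (rule has_integral_eq[of "{0..t}"])
    show "((\<lambda>s. f (z s) (u s) $ k) has_integral z t $ k - z 0 $ k) {0..t}"
      using z that k unfolding solves_upto_def by blast
  qed (use that in simp)
  show "((\<lambda>s. f (?Z s) (u s) $ k) has_integral ?Z t $ k - ?Z 0 $ k) {0..t}"
  proof (cases "t \<le> T")
    case True
    then show ?thesis using before[of t] t \<open>0 \<le> T\<close> by simp
  next
    case False
    have "((\<lambda>s. f (y s) (u (s + T)) $ k) has_integral y (t - T) $ k - y 0 $ k) {0..t - T}"
      using y False k by (auto simp: solves_on_def)
    from has_integral_shift_real_ivl[OF this, of "-T"]
    have "((\<lambda>s. f (y (s - T)) (u s) $ k) has_integral y (t - T) $ k - y 0 $ k) {T..t}"
      by simp
    \<comment> \<open>At \<open>s = T\<close> the glued curve takes the value \<open>z T\<close>,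
      which equals \<open>y 0\<close>, so the integrands agree on the closed interval.\<close>
    then have "((\<lambda>s. f (?Z s) (u s) $ k) has_integral y (t - T) $ k - y 0 $ k) {T..t}"
      using \<open>y 0 = z T\<close>
      by (elim has_integral_eq[of "{T..t}" "\<lambda>s. f (y (s - T)) (u s) $ k", rotated]) auto
    moreover have "((\<lambda>s. f (?Z s) (u s) $ k) has_integral z T $ k - z 0 $ k) {0..T}"
      using before[of T] \<open>0 \<le> T\<close> by simp
    ultimately have "((\<lambda>s. f (?Z s) (u s) $ k) has_integral
        (z T $ k - z 0 $ k) + (y (t - T) $ k - y 0 $ k)) {0..t}"
      using False \<open>0 \<le> T\<close> by (intro has_integral_combine[of 0 T t]) auto
    then show ?thesis using False \<open>0 \<le> T\<close> \<open>y 0 = z T\<close> by simp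
  qed
qed

section \<open>Global solutions for truncated right-hand sides\<close>

text \<open>The factor \<open>exp (- l * t)\<close> cancels the growth of the primitive
  \<open>C / l * exp (l * t)\<close>. The estimate serves twice: with the bound on the right-hand
  side it keeps the Picard operator bounded, with the Lipschitz constant it makes it a
  contraction.\<close>

lemma weighted_integral_bound:
  fixes h :: "real \<Rightarrow> 'a::euclidean_space"
  assumes "h integrable_on {0..t}" "0 \<le> t" "0 < l" "0 \<le> C"
    "\<And>s. s \<in> {0..t} \<Longrightarrow> norm (h s) \<le> C * exp (l * s)"
  shows "norm (exp (- l * t) *\<^sub>R integral {0..t} h) \<le> C / l"
proof -
  have hi: "((\<lambda>s. C * exp (l * s)) has_integral (C / l * exp (l * t) - C / l * exp (l * 0))) {0..t}"
    using assms(2,3)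
    by (intro fundamental_theorem_of_calculus)
       (auto intro!: derivative_eq_intros simp: has_real_derivative_iff_has_vector_derivative[symmetric])
  have "norm (integral {0..t} h) \<le> integral {0..t} (\<lambda>s. C * exp (l * s))"
    using assms hi by (intro Henstock_Kurzweil_Integration.integral_norm_bound_integral) auto
  also have "\<dots> \<le> C / l * exp (l * t)"
    using integral_unique[OF hi] assms by simp
  finally have "exp (- l * t) * norm (integral {0..t} h) \<le> exp (- l * t) * (C / l * exp (l * t))"
    by (intro mult_left_mono) auto
  also have "\<dots> = C / l"
    by (simp add: exp_minus field_simps)
  finally show ?thesis by simp
qed

text \<open>Writing \<open>x t = exp (l * t) *\<^sub>R y t\<close> with \<open>y\<close> bounded and continuous amounts to using a weighted
  supremum norm, in which the Picard operator is a contraction on the whole half-line.\<close>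
lemma caratheodory_global_solution:
  fixes g :: "real \<Rightarrow> 'a::euclidean_space \<Rightarrow> 'a"
  assumes meas: "\<And>x. continuous_on UNIV x \<Longrightarrow> (\<lambda>s. g s (x s)) \<in> borel_measurable (lebesgue_on {0..})"
    and bound: "\<And>s x. 0 \<le> s \<Longrightarrow> norm (g s x) \<le> M"
    and lip: "\<And>s x y. 0 \<le> s \<Longrightarrow> norm (g s x - g s y) \<le> L * norm (x - y)"
    and "0 \<le> L"
  shows "\<exists>x. x 0 = \<xi> \<and> (\<forall>t\<ge>0. ((\<lambda>s. g s (x s)) has_integral (x t - x 0)) {0..t})"
proof -
  have M0: "0 \<le> M" using norm_ge_zero bound[of 0] order_trans by blast
  \<comment> \<open>The factor 2 yields the contraction constant 1/2; the summand 1 keeps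
    \<open>l\<close> positive when \<open>L = 0\<close>.\<close>
  define l where "l = 2 * L + 1"
  have l: "0 < l" "L / l \<le> 1 / 2" using \<open>0 \<le> L\<close> by (auto simp: l_def field_simps)
  define G where "G y s = g s (exp (l * s) *\<^sub>R y s)" for y s
  have int: "G y integrable_on {0..t}" if "continuous_on UNIV y" for y t
  proof (rule measurable_bounded_by_integrable_imp_integrable)
    have "continuous_on UNIV (\<lambda>s. exp (l * s) *\<^sub>R y s)"
      using that by (intro continuous_intros)
    then have "G y \<in> borel_measurable (lebesgue_on {0..})"
      unfolding G_def by (rule meas)
    then show "G y \<in> borel_measurable (lebesgue_on {0..t})"
      by (rule measurable_restrict_mono) auto
    show "(\<lambda>_. M) integrable_on {0..t}" by auto
    show "norm (G y s) \<le> M" if "s \<in> {0..t}" for s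
      unfolding G_def using that by (intro bound) auto
  qed auto
  \<comment> \<open>The bounded continuous functions used here live on the whole line;
    \<open>max t 0\<close> extends the Picard operator constantly to negative times.\<close>
  define \<Phi> where "\<Phi> y t = exp (- l * max t 0) *\<^sub>R (\<xi> + integral {0..max t 0} (G y))" for y t
  have cont: "continuous_on UNIV (\<Phi> y)" if y: "continuous_on UNIV y" for y
  proof -
    have "isCont (\<Phi> y) t" for t
    proof -
      let ?N = "\<bar>t\<bar> + 1"
      have "continuous_on {0..?N} (\<lambda>t. integral {0..t} (G y))"
        by (rule indefinite_integral_continuous_1[OF int[OF y]])
      then have "continuous_on {..<?N} (\<lambda>t. integral {0..max t 0} (G y))"
        by (rule continuous_on_compose2) (auto intro!: continuous_intros)
      then have "continuous_on {..<?N} (\<Phi> y)"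
        unfolding \<Phi>_def by (intro continuous_intros)
      then show ?thesis
        by (rule continuous_on_interior) (auto simp: interior_open)
    qed
    then show ?thesis by (simp add: continuous_on_eq_continuous_at)
  qed
  have bdd: "norm (\<Phi> y t) \<le> norm \<xi> + M / l" if y: "continuous_on UNIV y" for y t
  proof -
    let ?t = "max t 0"
    have "M * 1 \<le> M * exp (l * s)" if "0 \<le> s" for s
      using that l M0 by (intro mult_left_mono) auto
    then have "norm (G y s) \<le> M * exp (l * s)" if "s \<in> {0..?t}" for s
      using order_trans[OF bound[of s "exp (l * s) *\<^sub>R y s"]] that unfolding G_def by simp
    then have "norm (exp (- l * ?t) *\<^sub>R integral {0..?t} (G y)) \<le> M / l"
      by (intro weighted_integral_bound int y l M0) auto
    moreover have "norm (exp (- l * ?t) *\<^sub>R \<xi>) \<le> norm \<xi>"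
      using l by (simp add: mult_left_le_one_le)
    moreover have "\<Phi> y t = exp (- l * ?t) *\<^sub>R \<xi> + exp (- l * ?t) *\<^sub>R integral {0..?t} (G y)"
      by (simp only: \<Phi>_def scaleR_add_right)
    ultimately show ?thesis
      by (metis add_mono norm_triangle_le)
  qed
  have in_bc: "\<Phi> y \<in> bcontfun" if "continuous_on UNIV y" for y
    using cont[OF that] bdd[OF that] by (auto simp: bcontfun_def bounded_iff)
  define F :: "(real \<Rightarrow>\<^sub>C 'a) \<Rightarrow> (real \<Rightarrow>\<^sub>C 'a)" where "F y = Bcontfun (\<Phi> (apply_bcontfun y))" for y
  have F: "apply_bcontfun (F y) t = \<Phi> (apply_bcontfun y) t" for y t
    unfolding F_def by (subst Bcontfun_inverse[OF in_bc]) auto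
  have "dist (F y) (F y') \<le> (1 / 2) * dist y y'" for y y'
  proof (rule dist_bound)
    fix t :: real
    let ?t = "max t 0"
    have c: "continuous_on UNIV (apply_bcontfun y)" "continuous_on UNIV (apply_bcontfun y')" by auto
    have "norm (G y s - G y' s) \<le> L * dist y y' * exp (l * s)" if "s \<in> {0..?t}" for s
    proof -
      have "norm (G y s - G y' s) \<le> L * norm (exp (l * s) *\<^sub>R y s - exp (l * s) *\<^sub>R y' s)"
        unfolding G_def using that by (intro lip) auto
      also have "\<dots> = L * (exp (l * s) * dist (y s) (y' s))"
        by (simp add: scaleR_diff_right[symmetric] dist_norm)
      also have "\<dots> \<le> L * (exp (l * s) * dist y y')"
        using \<open>0 \<le> L\<close> by (intro mult_left_mono dist_bounded) auto
      finally show ?thesis by (simp add: ac_simps)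
    qed
    then have "norm (exp (- l * ?t) *\<^sub>R integral {0..?t} (\<lambda>s. G y s - G y' s)) \<le> L * dist y y' / l"
      by (intro weighted_integral_bound integrable_diff int c l) (auto simp: \<open>0 \<le> L\<close>)
    also have "L * dist y y' / l = L / l * dist y y'" by simp
    also have "\<dots> \<le> 1 / 2 * dist y y'"
      using l by (intro mult_right_mono) auto
    finally have "norm (exp (- l * ?t) *\<^sub>R integral {0..?t} (\<lambda>s. G y s - G y' s)) \<le> 1 / 2 * dist y y'" .
    moreover have "F y t - F y' t = exp (- l * ?t) *\<^sub>R integral {0..?t} (\<lambda>s. G y s - G y' s)"
      unfolding F \<Phi>_def
      by (subst Henstock_Kurzweil_Integration.integral_diff[OF int[OF c(1)] int[OF c(2)]])
         (simp add: scaleR_diff_right[symmetric])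
    ultimately show "dist (F y t) (F y' t) \<le> 1 / 2 * dist y y'"
      by (simp add: dist_norm)
  qed
  then obtain y where y: "F y = y"
    using banach_fix_type[of "1/2" F] by auto
  have cy: "continuous_on UNIV (apply_bcontfun y)" by auto
  have eq: "exp (l * t) *\<^sub>R y t = \<xi> + integral {0..t} (G y)" if "0 \<le> t" for t
  proof -
    have "y t = \<Phi> (apply_bcontfun y) t" using F[of y t] y by simp
    also have "\<dots> = exp (- l * t) *\<^sub>R (\<xi> + integral {0..t} (G y))"
      using that by (simp add: \<Phi>_def)
    finally have "exp (l * t) *\<^sub>R y t = (exp (l * t) * exp (- l * t)) *\<^sub>R (\<xi> + integral {0..t} (G y))"
      by simp
    then show ?thesis by (simp add: exp_minus)
  qed
  define x where "x t = exp (l * t) *\<^sub>R y t" for t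
  have x0: "x 0 = \<xi>" using eq[of 0] by (simp add: x_def)
  have "((\<lambda>s. g s (x s)) has_integral (x t - x 0)) {0..t}" if "0 \<le> t" for t
  proof -
    have "(G y has_integral integral {0..t} (G y)) {0..t}"
      using int[OF cy] by (rule integrable_integral)
    moreover have "integral {0..t} (G y) = x t - x 0" using eq[OF that] x0 by (simp add: x_def)
    moreover have "G y = (\<lambda>s. g s (x s))" by (simp add: G_def x_def fun_eq_iff)
    ultimately show ?thesis by simp
  qed
  with x0 show ?thesis by blast
qed

text \<open>The projection is nonexpansive and confines the state to a compact ball. There
  continuity bounds \<open>f\<close>, and the local Lipschitz condition yields one constant for all
  inputs of norm at most the essential bound.\<close>

lemma truncated_solution_exists:
  fixes f :: "real^'d \<Rightarrow> real^'m \<Rightarrow> real^'d"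
  assumes f_cont: "continuous_on UNIV (\<lambda>(x, u). f x u)"
    and f_lip: "\<forall>r. \<forall>x0. \<exists>\<delta>>0. \<exists>L. \<forall>x\<in>ball x0 \<delta>. \<forall>y\<in>ball x0 \<delta>. \<forall>u.
                  norm u \<le> r \<longrightarrow> norm (f x u - f y u) \<le> L * dist x y"
    and u: "is_Linf u" and "0 \<le> R"
  shows "\<exists>z. z 0 = \<xi> \<and> solves_on (\<lambda>x. f (closest_point (cball 0 R) x)) UNIV z u"
proof -
  define U where "U = linf_norm (\<lambda>t. norm (u t))"
  \<comment> \<open>The input is bounded by \<open>U\<close> only almost everywhere, while the
    existence lemma asks for bounds at every time. Values are changed on a null set and restored at
    the end by \<open>has_integral_spike\<close>.\<close>
  define v where "v t = (if norm (u t) \<le> U then u t else 0)" for t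
  have U0: "0 \<le> U" unfolding U_def by (rule linf_norm_nonneg) auto
  have v: "norm (v t) \<le> U" for t using U0 by (simp add: v_def)
  let ?B = "cball (0::real^'d) R"
  let ?P = "closest_point ?B"
  have P: "?P x \<in> ?B" for x
    using \<open>0 \<le> R\<close> by (intro closest_point_in_set) auto
  have Pl: "dist (?P x) (?P y) \<le> dist x y" for x y
    using \<open>0 \<le> R\<close> by (intro closest_point_lipschitz) auto
  have Pc: "continuous_on UNIV ?P"
    using \<open>0 \<le> R\<close> by (intro continuous_on_closest_point) auto
  have "compact ((\<lambda>(x, u). f x u) ` (?B \<times> cball 0 U))"
    by (intro compact_continuous_image continuous_on_subset[OF f_cont] compact_Times) auto
  then obtain M where M': "\<forall>y\<in>(\<lambda>(x, u). f x u) ` (?B \<times> cball 0 U). norm y \<le> M"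
    by (meson compact_imp_bounded bounded_iff)
  have M: "norm (f x w) \<le> M" if "x \<in> ?B" "norm w \<le> U" for x w
    using M'[rule_format, of "f x w"] that by force
  have "local_lipschitz (cball 0 U) ?B (\<lambda>u x. f x u)"
  proof (rule local_lipschitzI)
    fix w x assume "w \<in> cball (0::real^'m) U" "x \<in> ?B"
    obtain \<delta> L where d: "\<delta> > 0" and L: "\<And>y y' w. y \<in> ball x \<delta> \<Longrightarrow> y' \<in> ball x \<delta> \<Longrightarrow> norm w \<le> U \<Longrightarrow>
        norm (f y w - f y' w) \<le> L * dist y y'"
      using f_lip[rule_format, of x U] by metis
    \<comment> \<open>The constant \<open>L\<close> obtained from the hypothesis may be negative,
      and halving the radius puts a closed ball inside the open one.\<close>
    have "\<bar>L\<bar>-lipschitz_on (cball x (\<delta>/2) \<inter> ?B) (\<lambda>x. f x w')" if "norm w' \<le> U" for w'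
    proof (rule lipschitz_onI)
      fix y y' assume "y \<in> cball x (\<delta>/2) \<inter> ?B" "y' \<in> cball x (\<delta>/2) \<inter> ?B"
      then have "dist (f y w') (f y' w') \<le> L * dist y y'"
        using L[of y y' w'] d that by (auto simp: dist_norm)
      also have "\<dots> \<le> \<bar>L\<bar> * dist y y'" by (intro mult_right_mono) auto
      finally show "dist (f y w') (f y' w') \<le> \<bar>L\<bar> * dist y y'" .
    qed auto
    then show "\<exists>u>0. \<exists>L. \<forall>t\<in>cball w u \<inter> cball 0 U. L-lipschitz_on (cball x u \<inter> ?B) (\<lambda>x. f x t)"
      using d by (intro exI[of _ "\<delta>/2"] conjI exI[of _ "\<bar>L\<bar>"]) auto
  qed
  moreover have "continuous_on (cball 0 U) (\<lambda>w. f x w)" for x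
  proof -
    have "continuous_on UNIV (\<lambda>w. (\<lambda>(x, u). f x u) (x, w))"
      by (rule continuous_on_compose2[OF f_cont]) (auto intro!: continuous_intros)
    then show ?thesis by (auto intro: continuous_on_subset)
  qed
  ultimately obtain L where L: "\<And>w. w \<in> cball 0 U \<Longrightarrow> L-lipschitz_on ?B (\<lambda>x. f x w)"
    using local_lipschitz_compact_implies_lipschitz[of "cball 0 U" ?B "\<lambda>u x. f x u"]
    by (metis compact_cball)
  have L0: "0 \<le> L" using L[of 0] U0 lipschitz_on_nonneg by auto
  have "\<exists>z. z 0 = \<xi> \<and> (\<forall>t\<ge>0. ((\<lambda>s. f (?P (z s)) (v s)) has_integral (z t - z 0)) {0..t})"
  proof (rule caratheodory_global_solution[where M=M and L=L])
    fix x :: "real \<Rightarrow> real^'d" assume x: "continuous_on UNIV x"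
    have [measurable]: "u \<in> borel_measurable (lebesgue_on {0..})" using u by (simp add: is_Linf_def)
    have vm: "v \<in> borel_measurable (lebesgue_on {0..})" unfolding v_def by measurable
    have "continuous_on {0..} (\<lambda>s. ?P (x s))"
      by (rule continuous_on_compose2[OF Pc]) (use x in \<open>auto intro: continuous_on_subset\<close>)
    then have "(\<lambda>s. ?P (x s)) \<in> borel_measurable (lebesgue_on {0..})"
      by (intro continuous_imp_measurable_on_sets_lebesgue) auto
    then have "(\<lambda>s. (?P (x s), v s)) \<in> borel_measurable (lebesgue_on {0..})"
      using vm by (rule borel_measurable_Pair)
    from measurable_compose[OF this borel_measurable_continuous_onI[OF f_cont]]
    show "(\<lambda>s. f (?P (x s)) (v s)) \<in> borel_measurable (lebesgue_on {0..})" by simp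
  next
    show "norm (f (?P x) (v s)) \<le> M" for s x using M P v by auto
    show "norm (f (?P x) (v s) - f (?P y) (v s)) \<le> L * norm (x - y)" for s x y
    proof -
      have "dist (f (?P x) (v s)) (f (?P y) (v s)) \<le> L * dist (?P x) (?P y)"
        using L[of "v s"] v[of s] P by (intro lipschitz_onD[of L ?B]) auto
      also have "\<dots> \<le> L * dist x y" using L0 Pl by (intro mult_left_mono) auto
      finally show ?thesis by (simp add: dist_norm)
    qed
  qed (rule L0)
  then obtain z where z: "z 0 = \<xi>"
    "\<And>t. t \<ge> 0 \<Longrightarrow> ((\<lambda>s. f (?P (z s)) (v s)) has_integral (z t - z 0)) {0..t}" by blast
  have "AE t in lebesgue. t \<in> {0..} \<longrightarrow> norm (u t) \<le> U"
    using is_Linf_AE[OF u] unfolding U_def by (subst (asm) AE_restrict_space_iff) auto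
  then obtain N where N: "negligible N" "{t. \<not> (t \<in> {0..} \<longrightarrow> norm (u t) \<le> U)} \<subseteq> N"
    by (auto simp: eventually_ae_filter_negligible)
  have "((\<lambda>s. f (?P (z s)) (u s)) has_integral (z t - z 0)) {0..t}" if "t \<ge> 0" for t
  proof (rule has_integral_spike[OF N(1) _ z(2)[OF that]])
    fix s assume "s \<in> {0..t} - N"
    then have "norm (u s) \<le> U" using N(2) by auto
    then show "f (?P (z s)) (u s) = f (?P (z s)) (v s)" by (simp add: v_def)
  qed
  then have "((\<lambda>s. f (?P (z s)) (u s) $ k) has_integral ((z t - z 0) $ k)) {0..t}" if "t \<ge> 0" for t k
    using has_integral_linear[OF _ bounded_linear_vec_nth, of _ "z t - z 0" "{0..t}" k] that
    by (simp add: o_def)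
  then show ?thesis using z(1) by (intro exI[of _ z]) (auto simp: solves_on_def)
qed

section \<open>Majorants of class KL\<close>

text \<open>In its use \<open>b\<close> is a supremum, monotone but with no continuity known. The
  average \<open>g\<close> lies between \<open>b s t\<close> and \<open>b (s * 2) t\<close>, so it
  dominates \<open>b\<close> and still decays; \<open>s / (1 + t)\<close> supplies strictness
  without spoiling the limit.\<close>

lemma KL_majorant:
  fixes b :: "real \<Rightarrow> real \<Rightarrow> real"
  assumes nonneg: "\<And>s t. 0 \<le> s \<Longrightarrow> 0 \<le> t \<Longrightarrow> 0 \<le> b s t"
    and mono_s: "\<And>s s' t. 0 \<le> s \<Longrightarrow> s \<le> s' \<Longrightarrow> 0 \<le> t \<Longrightarrow> b s t \<le> b s' t"
    and anti_t: "\<And>s t t'. 0 \<le> s \<Longrightarrow> 0 \<le> t \<Longrightarrow> t \<le> t' \<Longrightarrow> b s t' \<le> b s t"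
    and bound: "\<And>s t. 0 \<le> s \<Longrightarrow> 0 \<le> t \<Longrightarrow> b s t \<le> \<sigma> s" and \<sigma>: "gain \<sigma>"
    and lim: "\<And>s. 0 \<le> s \<Longrightarrow> (b s \<longlongrightarrow> 0) at_top"
  shows "\<exists>\<beta>. classKL \<beta> \<and> (\<forall>s\<ge>0. \<forall>t\<ge>0. b s t \<le> \<beta> s t)"
proof -
  \<comment> \<open>Averaging over \<open>[s, 2 s]\<close> makes the majorant continuous in \<open>s\<close>.\<close>
  define g where "g s t = integral {1..2} (\<lambda>q. b (s * q) t)" for s t
  have int: "(\<lambda>q. b (s * q) t) integrable_on {1..2}" if "0 \<le> s" "0 \<le> t" for s t
    using that by (intro integrable_on_mono_on mono_onI mono_s) (auto intro: mult_left_mono)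
  have lower: "b s t \<le> g s t" if "0 \<le> s" "0 \<le> t" for s t
  proof -
    have "integral {1..2} (\<lambda>q::real. b s t) \<le> g s t"
      unfolding g_def using that
      by (intro integral_le int mono_s) (auto simp: mult_le_cancel_left1)
    then show ?thesis by simp
  qed
  have upper: "g s t \<le> b (s * 2) t" if "0 \<le> s" "0 \<le> t" for s t
  proof -
    have "g s t \<le> integral {1..2} (\<lambda>q::real. b (s * 2) t)"
      unfolding g_def using that
      by (intro integral_le int mono_s) (auto intro!: mult_left_mono)
    then show ?thesis by simp
  qed
  have g_nonneg: "0 \<le> g s t" if "0 \<le> s" "0 \<le> t" for s t
    using lower[OF that] nonneg[OF that] by simp
  have b0: "b 0 t = 0" if "0 \<le> t" for t
    using bound[of 0 t] nonneg[of 0 t] gain_zero[OF \<sigma>] that by simp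
  have g_mono: "g s t \<le> g s' t" if "0 \<le> s" "s \<le> s'" "0 \<le> t" for s s' t
    unfolding g_def using that
    by (intro integral_le int mono_s) (auto intro!: mult_right_mono)
  have g_anti: "g s t' \<le> g s t" if "0 \<le> s" "0 \<le> t" "t \<le> t'" for s t t'
    unfolding g_def using that by (intro integral_le int anti_t) auto
  have g_lim: "(g s \<longlongrightarrow> 0) at_top" if "0 \<le> s" for s
  proof (rule tendsto_sandwich[OF _ _ tendsto_const lim[of "s * 2"]])
    show "\<forall>\<^sub>F t in at_top. 0 \<le> g s t" "\<forall>\<^sub>F t in at_top. g s t \<le> b (s * 2) t"
      using eventually_ge_at_top[of "0::real"]
      by (eventually_elim, use g_nonneg upper that in auto)+
  qed (use that in auto)
  have g_cont: "continuous_on {0..} (\<lambda>s. g s t)" if t: "0 \<le> t" for t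
    unfolding continuous_on_def
  proof
    fix s :: real assume "s \<in> {0..}"
    then consider "s = 0" | "0 < s" by fastforce
    then show "((\<lambda>s. g s t) \<longlongrightarrow> g s t) (at s within {0..})"
    proof cases
      case 1
      \<comment> \<open>The formula used for positive \<open>s\<close> divides by \<open>s\<close>,
        so continuity at 0 comes from squeezing \<open>g\<close> between 0 and
        \<open>\<sigma> (2 * s)\<close>.\<close>
      have "continuous_on {0..} (\<lambda>s. \<sigma> (2 * s))"
        using gain_compose[OF \<sigma> gain_cmult[OF gain_id, of 2]] by (simp add: gain_def)
      then have \<sigma>0: "((\<lambda>s. \<sigma> (2 * s)) \<longlongrightarrow> 0) (at 0 within {0..})"
        by (force simp: continuous_on_def gain_zero[OF \<sigma>])
      have "((\<lambda>s. g s t) \<longlongrightarrow> 0) (at 0 within {0..})"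
      proof (rule tendsto_sandwich[OF _ _ tendsto_const \<sigma>0])
        have ev: "\<forall>\<^sub>F s::real in at 0 within {0..}. s \<in> {0..}"
          by (auto simp: eventually_at_filter)
        show "\<forall>\<^sub>F s in at 0 within {0..}. 0 \<le> g s t"
          using ev by eventually_elim (use g_nonneg t in auto)
        show "\<forall>\<^sub>F s in at 0 within {0..}. g s t \<le> \<sigma> (2 * s)"
          using ev
        proof eventually_elim
          case (elim s)
          then show ?case
            using order_trans[OF upper[of s t] bound[of "s * 2" t]] t by (simp add: mult.commute)
        qed
      qed
      moreover have "g 0 t = 0" using upper[of 0 t] g_nonneg[of 0 t] b0 t by simp
      ultimately show ?thesis using 1 by simp
    next
      case 2
      define F where "F x = integral {0..x} (\<lambda>q. b q t)" for x
      have bint: "(\<lambda>q. b q t) integrable_on {0..x}" for x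
        using t by (intro integrable_on_mono_on mono_onI mono_s) auto
      \<comment> \<open>Rescaling the integration variable by \<open>s\<close> expresses the average
        through the primitive \<open>F\<close>, which is continuous even where \<open>b\<close>
        jumps.\<close>
      have geq: "g s t = (F (s * 2) - F s) / s" if "0 < s" for s
      proof -
        have "integral {0..s} (\<lambda>q. b q t) + integral {s..s*2} (\<lambda>q. b q t) = F (s * 2)"
          unfolding F_def by (rule Henstock_Kurzweil_Integration.integral_combine) (use that bint in auto)
        moreover have "(\<lambda>q. b q t) integrable_on {s..s*2}"
          by (rule integrable_on_subinterval[OF bint]) (use that in auto)
        ultimately have "((\<lambda>q. b q t) has_integral (F (s * 2) - F s)) {s..s*2}"
          by (simp add: has_integral_iff F_def)
        from has_integral_stretch_real[OF this, of s] that
        have "((\<lambda>q. b (s * q) t) has_integral (F (s * 2) - F s) / s) ((\<lambda>x. x / s) ` {s..s * 2})"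
          by simp
        moreover have "(\<lambda>x. x / s) ` {s..s * 2} = {1..2}"
          using that image_divide_atLeastAtMost[of s s "s * 2"] by simp
        ultimately show ?thesis unfolding g_def by (simp add: integral_unique)
      qed
      have "continuous_on {0..s * 4} F"
        unfolding F_def by (rule indefinite_integral_continuous_1[OF bint])
      then have F1: "continuous_on {0<..<s * 2} F"
        by (rule continuous_on_subset) (use 2 in auto)
      have "continuous_on {0<..<s * 2} (\<lambda>s. F (s * 2))"
        by (rule continuous_on_compose2[OF \<open>continuous_on {0..s * 4} F\<close>]) (auto intro!: continuous_intros)
      then have "continuous_on {0<..<s * 2} (\<lambda>s. (F (s * 2) - F s) / s)"
        by (intro continuous_on_divide continuous_on_diff F1 continuous_on_id) auto
      then have "isCont (\<lambda>s. (F (s * 2) - F s) / s) s"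
        using 2 by (simp add: continuous_on_eq_continuous_at)
      then have "((\<lambda>s. (F (s * 2) - F s) / s) \<longlongrightarrow> g s t) (at s)"
        using geq[OF 2] by (simp add: isCont_def)
      moreover have "\<forall>\<^sub>F x in at s. (F (x * 2) - F x) / x = g x t"
        using order_tendstoD(1)[OF tendsto_ident_at 2] by eventually_elim (simp add: geq)
      ultimately have "((\<lambda>s. g s t) \<longlongrightarrow> g s t) (at s)"
        by (rule Lim_transform_eventually)
      then show ?thesis by (rule tendsto_within_subset) auto
    qed
  qed
  define \<beta> where "\<beta> s t = g s t + s / (1 + t)" for s t
  have "classKL \<beta>"
    unfolding classKL_def
  proof (intro conjI allI impI)
    fix t :: real assume t: "0 \<le> t"
    have "continuous_on {0..} (\<lambda>s. \<beta> s t)"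
      unfolding \<beta>_def using t by (intro continuous_intros g_cont) auto
    moreover have "strict_mono_on {0..} (\<lambda>s. \<beta> s t)"
      unfolding \<beta>_def using t
      by (intro strict_mono_onI add_le_less_mono g_mono divide_strict_right_mono) auto
    moreover have "\<beta> 0 t = 0"
      using upper[of 0 t] g_nonneg[of 0 t] b0 t by (simp add: \<beta>_def)
    ultimately show "classK (\<lambda>s. \<beta> s t)" by (simp add: classK_def)
  next
    fix s t1 t2 :: real assume "0 \<le> s" "0 \<le> t1 \<and> t1 \<le> t2"
    then show "\<beta> s t2 \<le> \<beta> s t1"
      unfolding \<beta>_def by (intro add_mono g_anti divide_left_mono) auto
  next
    fix s :: real assume s: "0 \<le> s"
    have "((\<lambda>t. s / (1 + t)) \<longlongrightarrow> 0) at_top"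
      by (intro tendsto_divide_0[OF tendsto_const] filterlim_at_top_imp_at_infinity
          filterlim_tendsto_add_at_top[OF tendsto_const] filterlim_ident)
    from tendsto_add[OF g_lim[OF s] this] show "(\<beta> s \<longlongrightarrow> 0) at_top"
      by (simp add: \<beta>_def[abs_def])
  qed
  moreover have "b s t \<le> \<beta> s t" if "0 \<le> s" "0 \<le> t" for s t
    using lower[OF that] that by (simp add: \<beta>_def add_increasing2)
  ultimately show ?thesis by blast
qed

section \<open>The interconnection\<close>

lemma mixed_op_mono:
  assumes "b \<le> b'"
  shows "mixed_op n Isig \<gamma> b w i \<le> mixed_op n Isig \<gamma> b' w i"
  using assms by (auto simp: mixed_op_def)

lemma tendsto_Max_image:
  fixes g :: "'a \<Rightarrow> 'b \<Rightarrow> real"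
  assumes "finite A" "A \<noteq> {}" "\<And>a. a \<in> A \<Longrightarrow> (g a \<longlongrightarrow> l a) F"
  shows "((\<lambda>x. Max ((\<lambda>a. g a x) ` A)) \<longlongrightarrow> Max (l ` A)) F"
  using assms by (induction A rule: finite_ne_induct) (auto intro!: tendsto_max)

lemma tendsto_mixed_op:
  assumes g: "\<And>j. j < n \<Longrightarrow> gain (\<gamma> i j)" and "i < n"
    and b: "(b \<longlongrightarrow> b0) F" and X: "\<And>j. j < n \<Longrightarrow> ((\<lambda>m. X m j) \<longlongrightarrow> L j) F"
    and nn: "\<And>m j. j < n \<Longrightarrow> 0 \<le> X m j" "\<And>j. j < n \<Longrightarrow> 0 \<le> L j"
  shows "((\<lambda>m. mixed_op n Isig \<gamma> (b m) (X m) i) \<longlongrightarrow> mixed_op n Isig \<gamma> b0 L i) F"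
proof -
  have t: "((\<lambda>m. \<gamma> i j (X m j)) \<longlongrightarrow> \<gamma> i j (L j)) F" if "j < n" for j
    by (rule gain_tendsto) (use g X nn that in auto)
  have "((\<lambda>m. Gamma_op n Isig \<gamma> (X m) i) \<longlongrightarrow> Gamma_op n Isig \<gamma> L i) F"
  proof (cases "i \<in> Isig")
    case True
    then show ?thesis using t by (auto simp: Gamma_op_def intro!: tendsto_sum)
  next
    case False
    have "((\<lambda>m. Max ((\<lambda>j. \<gamma> i j (X m j)) ` {..<n})) \<longlongrightarrow> Max ((\<lambda>j. \<gamma> i j (L j)) ` {..<n})) F"
      by (rule tendsto_Max_image) (use t \<open>i < n\<close> in auto)
    then show ?thesis using False by (simp add: Gamma_op_def)
  qed
  then show ?thesis
    using b by (cases "i \<in> Isig") (auto simp: mixed_op_def intro!: tendsto_add tendsto_max)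
qed

lemma norm_bproj_le: "norm (bproj blk i v) \<le> norm v"
  unfolding norm_vec_def bproj_def by (intro L2_set_mono) auto

lemma norm_le_sum_bproj:
  assumes "blk ` UNIV = {..<n}"
  shows "norm v \<le> (\<Sum>i<n. norm (bproj blk i v))"
proof -
  have "blk k < n" for k using assms by auto
  then have "v = (\<Sum>i<n. bproj blk i v)"
    by (simp add: vec_eq_iff bproj_def sum.delta)
  then show ?thesis by (metis norm_sum)
qed

lemma continuous_on_bproj [continuous_intros]:
  assumes "continuous_on S z"
  shows "continuous_on S (\<lambda>t. bproj blk i (z t))"
proof -
  have "continuous_on S (\<lambda>t. if blk k = i then z t $ k else 0)" for k
    using assms by (cases "blk k = i") (auto intro!: continuous_intros)
  then show ?thesis unfolding bproj_def by (rule continuous_on_vec_lambda)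
qed

text \<open>The small-gain condition enters only through its consequence \<open>comparison\<close>,
  so the dynamical arguments inside never mention \<open>\<alpha>\<close> or
  \<open>D_op\<close>.\<close>

locale small_gain_interconnection =
  fixes f :: "real^'d \<Rightarrow> real^'m \<Rightarrow> real^'d"
    and blk :: "'d \<Rightarrow> nat" and n :: nat and Isig Imax :: "nat set"
    and \<beta> :: "nat \<Rightarrow> real \<Rightarrow> real \<Rightarrow> real"
    and \<gamma> :: "nat \<Rightarrow> nat \<Rightarrow> real \<Rightarrow> real"
    and \<gamma>u :: "nat \<Rightarrow> real \<Rightarrow> real"
    and \<phi> :: "real \<Rightarrow> real"
  assumes blocks: "blk ` UNIV = {..<n}"
    and f_cont: "continuous_on UNIV (\<lambda>(x, u). f x u)"
    and f_lip: "\<forall>r. \<forall>x0. \<exists>\<delta>>0. \<exists>L. \<forall>x\<in>ball x0 \<delta>. \<forall>y\<in>ball x0 \<delta>. \<forall>u.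
                  norm u \<le> r \<longrightarrow> norm (f x u - f y u) \<le> L * dist x y"
    and partition: "Isig \<union> Imax = {..<n}"
    and \<beta>_KL: "\<And>i. i < n \<Longrightarrow> classKL (\<beta> i)"
    and \<gamma>_gain: "\<And>i j. i < n \<Longrightarrow> j < n \<Longrightarrow> gain (\<gamma> i j)"
    and \<gamma>u_gain: "\<And>i. i < n \<Longrightarrow> gain (\<gamma>u i)"
    and sub_exists: "\<forall>i<n. \<forall>\<xi> w u. is_Linf u \<and> (\<forall>j<n. j \<noteq> i \<longrightarrow> is_Linf (\<lambda>t. bproj blk j (w t))) \<longrightarrow>
        (\<exists>z. (\<forall>t\<ge>0. \<forall>k. blk k \<noteq> i \<longrightarrow> z t $ k = w t $ k) \<and>
             bproj blk i (z 0) = bproj blk i \<xi> \<and> solves_on f {k. blk k = i} z u)"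
    and sub_ISS_sum: "\<forall>i\<in>Isig. \<forall>z u. is_Linf u \<and> (\<forall>j<n. j \<noteq> i \<longrightarrow> is_Linf (\<lambda>t. bproj blk j (z t)))
        \<and> solves_on f {k. blk k = i} z u \<longrightarrow>
        (\<forall>t\<ge>0. norm (bproj blk i (z t)) \<le>
            \<beta> i (norm (bproj blk i (z 0))) t
          + (\<Sum>j<n. \<gamma> i j (linf_norm (trunc t (\<lambda>s. norm (bproj blk j (z s))))))
          + \<gamma>u i (linf_norm (\<lambda>s. norm (u s))))"
    and sub_ISS_max: "\<forall>i\<in>Imax. \<forall>z u. is_Linf u \<and> (\<forall>j<n. j \<noteq> i \<longrightarrow> is_Linf (\<lambda>t. bproj blk j (z t)))
        \<and> solves_on f {k. blk k = i} z u \<longrightarrow>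
        (\<forall>t\<ge>0. norm (bproj blk i (z t)) \<le>
            max (\<beta> i (norm (bproj blk i (z 0))) t)
             (max (Max ((\<lambda>j. \<gamma> i j (linf_norm (trunc t (\<lambda>s. norm (bproj blk j (z s)))))) ` {..<n}))
                  (\<gamma>u i (linf_norm (\<lambda>s. norm (u s))))))"
    and \<phi>_gain: "gain \<phi>"
    and comparison: "\<And>b w i. 0 \<le> b \<Longrightarrow> (\<And>j. j < n \<Longrightarrow> 0 \<le> w j) \<Longrightarrow>
        (\<And>j. j < n \<Longrightarrow> w j \<le> mixed_op n Isig \<gamma> b w j) \<Longrightarrow> i < n \<Longrightarrow> w i \<le> \<phi> b"
begin

lemma \<beta>_gain: "i < n \<Longrightarrow> 0 \<le> t \<Longrightarrow> gain (\<lambda>s. \<beta> i s t)"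
  using \<beta>_KL classK_gain by (auto simp: classKL_def)

lemma \<beta>_anti: "i < n \<Longrightarrow> 0 \<le> s \<Longrightarrow> 0 \<le> t \<Longrightarrow> t \<le> t' \<Longrightarrow> \<beta> i s t' \<le> \<beta> i s t"
  using \<beta>_KL[of i] by (auto simp: classKL_def)

lemma \<beta>_tendsto: "i < n \<Longrightarrow> 0 \<le> s \<Longrightarrow> (\<beta> i s \<longlongrightarrow> 0) at_top"
  using \<beta>_KL[of i] by (auto simp: classKL_def)

text \<open>The hypotheses on the subsystems only speak about bounded inputs on \<open>[0,\<infinity>)\<close>. After time \<open>T\<close> the
  other blocks are therefore frozen and block \<open>i\<close> is continued by the solution from \<open>sub_exists\<close>.\<close>
lemma interval_estimate:
  assumes u: "is_Linf u" and z: "solves_upto f UNIV T z u" and i: "i < n" and t: "t \<in> {0..T}"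
    and w: "\<And>j s. j < n \<Longrightarrow> s \<in> {0..T} \<Longrightarrow> norm (bproj blk j (z s)) \<le> w j"
  shows "norm (bproj blk i (z t)) \<le>
    mixed_op n Isig \<gamma> (\<beta> i (norm (bproj blk i (z 0))) t + \<gamma>u i (linf_norm (\<lambda>s. norm (u s)))) w i"
proof -
  have T: "0 \<le> T" using t by auto
  let ?v = "\<lambda>t. u (t + T)"
  have "is_Linf (\<lambda>t::real. bproj blk j (z T))" for j
    by (rule is_Linf_continuous[where M="norm (bproj blk j (z T))"]) auto
  then obtain y where y: "\<forall>t\<ge>0. \<forall>k. blk k \<noteq> i \<longrightarrow> y t $ k = z T $ k"
      "bproj blk i (y 0) = bproj blk i (z T)" "solves_on f {k. blk k = i} y ?v"
    using sub_exists[rule_format, of i ?v "\<lambda>_. z T" "z T"] i is_Linf_shift(1)[OF u T] by blast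
  have y0: "y 0 = z T"
  proof (rule vec_eq_iff[THEN iffD2, rule_format])
    fix k
    show "y 0 $ k = z T $ k"
    proof (cases "blk k = i")
      case True
      then show ?thesis
        using arg_cong[OF y(2), of "\<lambda>v. v $ k"] by (simp add: bproj_def)
    qed (use y(1) in auto)
  qed
  define Z where "Z = (\<lambda>t. if t \<le> T then z t else y (t - T))"
  have Z_eq: "Z s = z s" if "s \<le> T" for s using that by (simp add: Z_def)
  have "solves_on f {k. blk k = i} Z u"
    unfolding Z_def by (rule solves_on_glue[OF solves_upto_mono[OF z] y(3) T y0]) auto
  moreover have "is_Linf (\<lambda>t. bproj blk j (Z t))" if j: "j < n" "j \<noteq> i" for j
  proof (rule is_Linf_continuous)
    \<comment> \<open>Off block \<open>i\<close> the glued curve is \<open>z\<close> stopped at time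
      \<open>T\<close>: continuous and bounded by \<open>w j\<close>, hence an admissible
      input.\<close>
    have eq: "bproj blk j (Z s) = bproj blk j (z (min s T))" if "0 \<le> s" for s
      using y(1) that j by (auto simp: Z_def bproj_def vec_eq_iff min_def)
    have "continuous_on {0..} (\<lambda>s. bproj blk j (z (min s T)))"
      by (intro continuous_on_bproj continuous_on_compose2[OF solves_upto_continuous[OF z]] continuous_intros)
         (use T in auto)
    then show "continuous_on {0..} (\<lambda>s. bproj blk j (Z s))"
      by (subst continuous_on_cong[OF refl eq]) auto
    show "norm (bproj blk j (Z s)) \<le> w j" if "0 \<le> s" for s
      using eq[OF that] w[OF j(1)] that T by auto
  qed
  ultimately have sol: "is_Linf u \<and> (\<forall>j<n. j \<noteq> i \<longrightarrow> is_Linf (\<lambda>t. bproj blk j (Z t)))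
      \<and> solves_on f {k. blk k = i} Z u"
    using u by blast
  have w0: "0 \<le> w j" if "j < n" for j
    using order_trans[OF norm_ge_zero w[OF that, of 0]] T by simp
  \<comment> \<open>Truncation at \<open>t \<le> T\<close> hides the artificial continuation, so
    only values of \<open>z\<close> enter the estimate.\<close>
  let ?X = "\<lambda>j. linf_norm (trunc t (\<lambda>s. norm (bproj blk j (Z s))))"
  have X: "\<gamma> i j (?X j) \<le> \<gamma> i j (w j)" if "j < n" for j
  proof (rule gain_mono[OF \<gamma>_gain[OF i that]])
    show "0 \<le> ?X j" by (rule linf_norm_nonneg) (simp add: trunc_def)
    show "?X j \<le> w j"
      using w[OF that] w0[OF that] t Z_eq by (intro linf_norm_le) (auto simp: trunc_def)
  qed
  let ?b = "\<beta> i (norm (bproj blk i (z 0))) t" and ?c = "\<gamma>u i (linf_norm (\<lambda>s. norm (u s)))"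
  have nn: "0 \<le> ?b" "0 \<le> ?c"
    using gain_nonneg[OF \<beta>_gain] gain_nonneg[OF \<gamma>u_gain] linf_norm_nonneg i t by auto
  have Zz: "Z t = z t" "Z 0 = z 0" using Z_eq t T by auto
  show ?thesis
  proof (cases "i \<in> Isig")
    case True
    then have "norm (bproj blk i (z t)) \<le> ?b + (\<Sum>j<n. \<gamma> i j (?X j)) + ?c"
      using sub_ISS_sum[rule_format, OF True sol, of t] t Zz by simp
    moreover have "(\<Sum>j<n. \<gamma> i j (?X j)) \<le> (\<Sum>j<n. \<gamma> i j (w j))"
      using X by (intro sum_mono) auto
    ultimately show ?thesis using True by (simp add: mixed_op_def Gamma_op_def)
  next
    case False
    then have "i \<in> Imax" using partition i by auto
    then have "norm (bproj blk i (z t)) \<le> max ?b (max (Max ((\<lambda>j. \<gamma> i j (?X j)) ` {..<n})) ?c)"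
      using sub_ISS_max[rule_format, OF _ sol, of t] t Zz by simp
    moreover have "\<gamma> i j (?X j) \<le> Max ((\<lambda>j. \<gamma> i j (w j)) ` {..<n})" if "j < n" for j
      using X[OF that] that by (intro order_trans[OF X[OF that]] Max_ge) auto
    then have "Max ((\<lambda>j. \<gamma> i j (?X j)) ` {..<n}) \<le> Max ((\<lambda>j. \<gamma> i j (w j)) ` {..<n})"
      using i by (intro Max.boundedI) auto
    \<comment> \<open>The maximum of the nonnegative transient and input terms is at most their sum,
      so both kinds of row can share one perturbation.\<close>
    ultimately show ?thesis using False nn by (auto simp: mixed_op_def Gamma_op_def)
  qed
qed

section \<open>A priori bounds and global existence\<close>

definition B :: "real \<Rightarrow> real" where "B r = (\<Sum>i<n. \<beta> i r 0)"

definition G :: "real \<Rightarrow> real" where "G r = (\<Sum>i<n. \<gamma>u i r)"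

lemma gain_B: "gain B"
  unfolding B_def by (intro gain_sum \<beta>_gain) auto

lemma gain_G: "gain G"
  unfolding G_def by (intro gain_sum \<gamma>u_gain) auto

lemma \<gamma>u_le_G: "i < n \<Longrightarrow> 0 \<le> r \<Longrightarrow> \<gamma>u i r \<le> G r"
  unfolding G_def using gain_nonneg[OF \<gamma>u_gain] by (intro member_le_sum) auto

lemma \<beta>_le_B: "i < n \<Longrightarrow> 0 \<le> r \<Longrightarrow> \<beta> i r 0 \<le> B r"
  unfolding B_def using gain_nonneg[OF \<beta>_gain] by (intro member_le_sum) auto

lemma interval_bound:
  assumes u: "is_Linf u" and z: "solves_upto f UNIV T z u" and "i < n" and "t \<in> {0..T}"
  shows "norm (bproj blk i (z t)) \<le> \<phi> (B (norm (z 0)) + G (linf_norm (\<lambda>s. norm (u s))))"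
proof -
  let ?U = "linf_norm (\<lambda>s. norm (u s))"
  define w where "w j = (SUP s\<in>{0..T}. norm (bproj blk j (z s)))" for j
  have bdd: "bdd_above ((\<lambda>s. norm (bproj blk j (z s))) ` {0..T})" for j
    by (intro bounded_imp_bdd_above compact_imp_bounded compact_continuous_image
        continuous_intros solves_upto_continuous[OF z]) auto
  have w: "norm (bproj blk j (z s)) \<le> w j" if "s \<in> {0..T}" for j s
    unfolding w_def using bdd that by (rule cSUP_upper2) simp
  have U: "0 \<le> ?U" by (rule linf_norm_nonneg) simp
  have "w i \<le> \<phi> (B (norm (z 0)) + G ?U)"
  proof (rule comparison)
    show "0 \<le> B (norm (z 0)) + G ?U"
      using gain_nonneg[OF gain_B] gain_nonneg[OF gain_G] U by simp
    show "0 \<le> w j" for j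
      using order_trans[OF norm_ge_zero w] \<open>t \<in> {0..T}\<close> by blast
    show "w j \<le> mixed_op n Isig \<gamma> (B (norm (z 0)) + G ?U) w j" if j: "j < n" for j
      unfolding w_def[of j]
    proof (rule cSUP_least)
      fix s assume s: "s \<in> {0..T}"
      have "\<beta> j (norm (bproj blk j (z 0))) s \<le> \<beta> j (norm (bproj blk j (z 0))) 0"
        using s j by (intro \<beta>_anti) auto
      also have "\<dots> \<le> \<beta> j (norm (z 0)) 0"
        by (intro gain_mono[OF \<beta>_gain[OF j, of 0]] norm_bproj_le) auto
      also have "\<dots> \<le> B (norm (z 0))" using j by (intro \<beta>_le_B) auto
      finally have "\<beta> j (norm (bproj blk j (z 0))) s + \<gamma>u j ?U \<le> B (norm (z 0)) + G ?U"
        using \<gamma>u_le_G[OF j U] by simp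
      from order_trans[OF interval_estimate[OF u z j s w] mixed_op_mono[OF this]]
      show "norm (bproj blk j (z s)) \<le> mixed_op n Isig \<gamma> (B (norm (z 0)) + G ?U) w j" .
    qed (use \<open>t \<in> {0..T}\<close> in auto)
  qed fact
  with w[OF \<open>t \<in> {0..T}\<close>, of i] show ?thesis by simp
qed

lemma interval_norm_bound:
  assumes "is_Linf u" "solves_upto f UNIV T z u" "t \<in> {0..T}"
  shows "norm (z t) \<le> real n * \<phi> (B (norm (z 0)) + G (linf_norm (\<lambda>s. norm (u s))))"
proof -
  have "(\<Sum>i<n. norm (bproj blk i (z t))) \<le>
      (\<Sum>i<n. \<phi> (B (norm (z 0)) + G (linf_norm (\<lambda>s. norm (u s)))))"
    using interval_bound[OF assms(1,2)] assms(3) by (intro sum_mono) auto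
  then show ?thesis using norm_le_sum_bproj[OF blocks, of "z t"] by simp
qed

lemma global_solution_exists:
  assumes u: "is_Linf u"
  shows "\<exists>z. z 0 = \<xi> \<and> solves_on f UNIV z u"
proof -
  define R where "R = real n * \<phi> (B (norm \<xi>) + G (linf_norm (\<lambda>s. norm (u s))))"
  have "0 \<le> B (norm \<xi>) + G (linf_norm (\<lambda>s. norm (u s)))"
    using gain_nonneg[OF gain_B] gain_nonneg[OF gain_G] linf_norm_nonneg by simp
  then have R: "0 \<le> R" using gain_nonneg[OF \<phi>_gain] by (simp add: R_def)
  \<comment> \<open>The extra 1 leaves a gap between the a priori bound \<open>R\<close> and the
    radius up to which the projected system agrees with the original one.\<close>
  let ?P = "closest_point (cball (0::real^'d) (R + 1))"
  obtain z where z0: "z 0 = \<xi>" and z: "solves_on (\<lambda>x. f (?P x)) UNIV z u"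
    using truncated_solution_exists[OF f_cont f_lip u, of "R + 1" \<xi>] R by auto
  \<comment> \<open>The curve obeys the original equation only as long as it is known to stay in the
    ball; for this reason the a priori bound was proved for \<open>solves_upto\<close>.\<close>
  have inside: "solves_upto f UNIV T z u" if "\<And>t. t \<in> {0..T} \<Longrightarrow> norm (z t) \<le> R + 1" for T
    unfolding solves_upto_def
  proof (intro ballI)
    fix t k assume t: "t \<in> {0..T}"
    have "((\<lambda>s. f (?P (z s)) (u s) $ k) has_integral z t $ k - z 0 $ k) {0..t}"
      using z t by (simp add: solves_on_def)
    then show "((\<lambda>s. f (z s) (u s) $ k) has_integral z t $ k - z 0 $ k) {0..t}"
      by (rule has_integral_eq[rotated]) (use that t in \<open>auto simp: closest_point_self\<close>)
  qed
  have bound: "norm (z t) \<le> R" if "t \<in> {0..T}" "solves_upto f UNIV T z u" for t T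
    using interval_norm_bound[OF u that(2,1)] by (simp add: R_def z0)
  \<comment> \<open>On the degenerate interval \<open>[0,0]\<close> every curve is a solution, so
    the a priori bound already places the initial value within radius \<open>R\<close>.\<close>
  have "solves_upto f UNIV 0 z u"
    by (auto simp: solves_upto_def intro: has_integral_null_real)
  then have z0R: "norm (z 0) \<le> R" using bound[of 0 0] by simp
  have stay: "norm (z t1) \<le> R + 1" if "0 \<le> t1" for t1
  proof (rule ccontr)
    assume out: "\<not> norm (z t1) \<le> R + 1"
    have "continuous_on {0..t1} z"
      using solves_upto_continuous[OF solves_on_imp_upto[OF z]] .
    then have cont: "continuous_on {0..t1} (\<lambda>t. norm (z t))"
      by (intro continuous_intros)
    let ?A = "{0..t1} \<inter> (\<lambda>t. norm (z t)) -` {R + 1..}"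
    have "closed ?A"
      by (rule continuous_closed_preimage[OF cont]) auto
    moreover have "bounded ?A" by (rule bounded_subset[of "{0..t1}"]) auto
    ultimately have "compact ?A" by (simp add: compact_eq_bounded_closed)
    moreover have "?A \<noteq> {}" using out that by auto
    \<comment> \<open>\<open>\<tau>\<close> is the first time at which the norm reaches
      \<open>R + 1\<close>. Up to and including \<open>\<tau>\<close> the original equation holds,
      so the a priori bound gives norm at most \<open>R\<close> there.\<close>
    ultimately have "\<exists>\<tau>\<in>?A. \<forall>t\<in>?A. \<tau> \<le> t" by (rule compact_attains_inf)
    then obtain \<tau> where \<tau>: "\<tau> \<in> ?A" "\<And>t. t \<in> ?A \<Longrightarrow> \<tau> \<le> t" by (elim bexE) simp
    have "continuous_on {0..\<tau>} (\<lambda>t. norm (z t))"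
      by (rule continuous_on_subset[OF cont]) (use \<tau>(1) in auto)
    then have "\<exists>t\<ge>0. t \<le> \<tau> \<and> norm (z t) = R + 1"
      using IVT'[of "\<lambda>t. norm (z t)" 0 "R + 1" \<tau>] \<tau>(1) z0R by auto
    then obtain t where "0 \<le> t" "t \<le> \<tau>" "norm (z t) = R + 1" by blast
    moreover from this have "\<tau> \<le> t" using \<tau> by auto
    ultimately have \<tau>R: "norm (z \<tau>) = R + 1" by simp
    have "norm (z s) \<le> R + 1" if "s \<in> {0..\<tau>}" for s
      using \<tau>(2)[of s] \<tau>(1) \<tau>R that by (cases "s = \<tau>") force+
    then have "norm (z \<tau>) \<le> R" using \<tau>(1) by (intro bound[of \<tau> \<tau>] inside) auto
    with \<tau>R show False by simp
  qed
  have "solves_upto f UNIV T z u" for T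
    by (rule inside) (use stay in auto)
  then have "solves_on f UNIV z u"
    unfolding solves_on_def solves_upto_def by (meson atLeastAtMost_iff order_refl)
  with z0 show ?thesis by blast
qed

section \<open>Attraction uniform over families of trajectories\<close>

lemma block_attraction:
  assumes r: "0 \<le> r" and U: "0 \<le> U" and \<epsilon>: "0 < \<epsilon>"
  shows "\<exists>T\<ge>0. \<forall>z u t i. is_Linf u \<and> solves_on f UNIV z u \<and> norm (z 0) \<le> r \<and>
    linf_norm (\<lambda>s. norm (u s)) \<le> U \<and> T \<le> t \<and> i < n \<longrightarrow> norm (bproj blk i (z t)) \<le> \<phi> (G U) + \<epsilon>"
proof -
  define traj where "traj z u \<longleftrightarrow> is_Linf u \<and> solves_on f UNIV z u \<and> norm (z 0) \<le> r \<and>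
    linf_norm (\<lambda>s. norm (u s)) \<le> U" for z u
  define R where "R = \<phi> (B r + G U)"
  have Un: "0 \<le> linf_norm (\<lambda>s. norm (u s))" for u :: "real \<Rightarrow> real^'m" by (rule linf_norm_nonneg) simp
  have R: "norm (bproj blk i (z t)) \<le> R" if "traj z u" "0 \<le> t" "i < n" for z u t i
  proof -
    have "norm (bproj blk i (z t)) \<le> \<phi> (B (norm (z 0)) + G (linf_norm (\<lambda>s. norm (u s))))"
      using that by (intro interval_bound[of _ t] solves_on_imp_upto) (auto simp: traj_def)
    also have "\<dots> \<le> R"
      unfolding R_def using that Un
      by (intro gain_mono[OF \<phi>_gain] add_mono gain_mono[OF gain_B] gain_mono[OF gain_G]
          add_nonneg_nonneg gain_nonneg[OF gain_B] gain_nonneg[OF gain_G]) (auto simp: traj_def)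
    finally show ?thesis .
  qed
  have R0: "0 \<le> R" unfolding R_def
    by (intro gain_nonneg[OF \<phi>_gain] add_nonneg_nonneg gain_nonneg[OF gain_B] gain_nonneg[OF gain_G] r U)
  \<comment> \<open>Inserting 0 keeps the set nonempty and its supremum nonnegative without
    exhibiting a trajectory.\<close>
  define S where "S i m = insert 0 {norm (bproj blk i (z t)) | z u t. traj z u \<and> real m \<le> t}" for i m
  define X where "X m i = Sup (S i m)" for m i
  have S_bdd: "bdd_above (S i m)" if "i < n" for i m
  proof (rule bdd_aboveI[of _ R])
    fix x assume "x \<in> S i m"
    then show "x \<le> R" using R R0 that of_nat_0_le_iff[of m] order_trans unfolding S_def by blast
  qed
  have X_upper: "norm (bproj blk i (z t)) \<le> X m i" if "traj z u" "real m \<le> t" "i < n" for z u t i m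
    unfolding X_def using that by (intro cSup_upper S_bdd) (auto simp: S_def)
  have X0: "0 \<le> X m i" if "i < n" for m i
    unfolding X_def using that by (intro cSup_upper S_bdd) (auto simp: S_def)
  have X_dec: "decseq (\<lambda>m. X m i)" if "i < n" for i
    unfolding decseq_def X_def
  proof (intro allI impI)
    fix m m' :: nat assume "m \<le> m'"
    then have "S i m' \<subseteq> S i m" unfolding S_def by force
    then show "Sup (S i m') \<le> Sup (S i m)"
      using S_bdd[OF that] by (intro cSup_subset_mono) (auto simp: S_def)
  qed
  have "\<exists>L. (\<lambda>m. X m i) \<longlonglongrightarrow> L" if "i < n" for i
    using decseq_convergent[OF X_dec[OF that], of 0] X0[OF that] by blast
  then obtain L where L: "\<And>i. i < n \<Longrightarrow> (\<lambda>m. X m i) \<longlonglongrightarrow> L i" by metis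
  have L0: "0 \<le> L i" if "i < n" for i
    using LIMSEQ_le_const[OF L[OF that], of 0] X0[OF that] by blast
  \<comment> \<open>A trajectory observed at a time at least \<open>m + m\<close> is restarted at
    \<open>m\<close>. Its blocks are then bounded by \<open>R\<close>, at least \<open>m\<close>
    time units remain for the transient to decay, and all later block values are bounded by
    \<open>X m\<close>. Since \<open>X (m + m)\<close> and \<open>X m\<close> have the same limit,
    the limit vector satisfies the inequality without the transient.\<close>
  have step: "X (m + m) i \<le> mixed_op n Isig \<gamma> (\<beta> i R (real m) + \<gamma>u i U) (X m) i" if i: "i < n" for m i
  proof -
    have mixed0: "0 \<le> mixed_op n Isig \<gamma> (\<beta> i R (real m) + \<gamma>u i U) (X m) i"
    proof -
      have "0 \<le> Gamma_op n Isig \<gamma> (X m) i"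
        by (rule Gamma_op_nonneg) (use \<gamma>_gain i X0 in auto)
      moreover have "0 \<le> \<beta> i R (real m) + \<gamma>u i U"
        using gain_nonneg[OF \<beta>_gain[OF i, of "real m"] R0] gain_nonneg[OF \<gamma>u_gain[OF i] U] by simp
      ultimately show ?thesis by (simp add: mixed_op_def le_max_iff_disj)
    qed
    have "x \<le> mixed_op n Isig \<gamma> (\<beta> i R (real m) + \<gamma>u i U) (X m) i" if x: "x \<in> S i (m + m)" for x
    proof -
      consider "x = 0" | z u t where "traj z u" "real m + real m \<le> t" "x = norm (bproj blk i (z t))"
        using x unfolding S_def of_nat_add by blast
      then show ?thesis
      proof cases
        case 2
        let ?z = "\<lambda>s. z (s + real m)" and ?u = "\<lambda>s. u (s + real m)" and ?t = "t - real m"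
        have tr: "is_Linf u" "solves_on f UNIV z u" "linf_norm (\<lambda>s. norm (u s)) \<le> U"
          using 2(1) by (auto simp: traj_def)
        have "solves_upto f UNIV ?t ?z ?u"
          by (intro solves_on_imp_upto solves_on_shift tr) simp
        moreover have "is_Linf ?u" by (intro is_Linf_shift tr) simp
        ultimately have "norm (bproj blk i (?z ?t)) \<le> mixed_op n Isig \<gamma>
            (\<beta> i (norm (bproj blk i (?z 0))) ?t + \<gamma>u i (linf_norm (\<lambda>s. norm (?u s)))) (X m) i"
          using i 2 X_upper[OF 2(1)] by (intro interval_estimate) auto
        also have "\<dots> \<le> mixed_op n Isig \<gamma> (\<beta> i R (real m) + \<gamma>u i U) (X m) i"
        proof (intro mixed_op_mono add_mono)
          have "\<beta> i (norm (bproj blk i (?z 0))) ?t \<le> \<beta> i R ?t"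
            using R[OF 2(1) _ i, of "real m"] 2(2) by (intro gain_mono[OF \<beta>_gain[OF i]]) auto
          also have "\<dots> \<le> \<beta> i R (real m)" using 2(2) i R0 by (intro \<beta>_anti) auto
          finally show "\<beta> i (norm (bproj blk i (?z 0))) ?t \<le> \<beta> i R (real m)" .
          have "linf_norm (\<lambda>s. norm (?u s)) \<le> linf_norm (\<lambda>s. norm (u s))"
            by (rule is_Linf_shift(2)[OF tr(1)]) simp
          then show "\<gamma>u i (linf_norm (\<lambda>s. norm (?u s))) \<le> \<gamma>u i U"
            using tr(3) Un[of ?u] by (intro gain_mono[OF \<gamma>u_gain[OF i]]) auto
        qed
        finally show ?thesis using 2(3) by simp
      qed (use mixed0 in auto)
    qed
    then show ?thesis unfolding X_def[of "m + m"] by (intro cSup_least) (auto simp: S_def)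
  qed
  have "L i \<le> mixed_op n Isig \<gamma> (G U) L i" if i: "i < n" for i
  proof -
    have "(\<lambda>m. \<beta> i R (real m) + \<gamma>u i U) \<longlonglongrightarrow> 0 + \<gamma>u i U"
      by (intro tendsto_add tendsto_const filterlim_compose[OF \<beta>_tendsto[OF i R0]] filterlim_real_sequentially)
    then have "(\<lambda>m. mixed_op n Isig \<gamma> (\<beta> i R (real m) + \<gamma>u i U) (X m) i)
        \<longlonglongrightarrow> mixed_op n Isig \<gamma> (0 + \<gamma>u i U) L i"
      by (intro tendsto_mixed_op \<gamma>_gain i L X0 L0)
    moreover have "(\<lambda>m. X (m + m) i) \<longlonglongrightarrow> L i"
      using LIMSEQ_subseq_LIMSEQ[OF L[OF i], of "\<lambda>m. m + m"] by (simp add: strict_mono_def o_def)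
    ultimately have "L i \<le> mixed_op n Isig \<gamma> (0 + \<gamma>u i U) L i"
      using step[OF i] by (intro LIMSEQ_le) auto
    also have "\<dots> \<le> mixed_op n Isig \<gamma> (G U) L i"
      using \<gamma>u_le_G[OF i U] by (intro mixed_op_mono) simp
    finally show ?thesis .
  qed
  then have L\<phi>: "L i \<le> \<phi> (G U)" if "i < n" for i
    using that L0 gain_nonneg[OF gain_G U] by (intro comparison) auto
  have "\<forall>i\<in>{..<n}. \<forall>\<^sub>F m in sequentially. X m i < \<phi> (G U) + \<epsilon>"
  proof
    fix i assume "i \<in> {..<n}"
    then show "\<forall>\<^sub>F m in sequentially. X m i < \<phi> (G U) + \<epsilon>"
      using order_tendstoD(2)[OF L, of i "\<phi> (G U) + \<epsilon>"] L\<phi>[of i] \<epsilon> by auto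
  qed
  then have "\<forall>\<^sub>F m in sequentially. \<forall>i\<in>{..<n}. X m i < \<phi> (G U) + \<epsilon>"
    by (intro eventually_ball_finite) auto
  then obtain m where m: "\<And>i. i < n \<Longrightarrow> X m i < \<phi> (G U) + \<epsilon>"
    by (auto simp: eventually_sequentially)
  have "norm (bproj blk i (z t)) \<le> \<phi> (G U) + \<epsilon>" if "traj z u" "real m \<le> t" "i < n" for z u t i
    using X_upper[OF that] m[OF that(3)] by simp
  then show ?thesis unfolding traj_def by (intro exI[of _ "real m"]) auto
qed

text \<open>The factor 2 comes from
  \<open>\<phi> (x + y) \<le> \<phi> (2 * x) + \<phi> (2 * y)\<close>, which separates initial value
  and input; \<open>real n\<close> comes from bounding the norm by the sum of the block
  norms.\<close>

definition \<sigma> :: "real \<Rightarrow> real" where "\<sigma> r = real n * \<phi> (2 * B r)"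

definition \<psi> :: "real \<Rightarrow> real" where "\<psi> r = real n * \<phi> (2 * G r)"

lemma gain_\<sigma>: "gain \<sigma>" and gain_\<psi>: "gain \<psi>"
  unfolding \<sigma>_def \<psi>_def
  by (intro gain_cmult[OF gain_compose[OF \<phi>_gain gain_cmult]] gain_B gain_G; simp)+

lemma global_bound:
  assumes "is_Linf u" "solves_on f UNIV z u" "0 \<le> t"
  shows "norm (z t) \<le> \<sigma> (norm (z 0)) + \<psi> (linf_norm (\<lambda>s. norm (u s)))"
proof -
  let ?x = "B (norm (z 0))" and ?y = "G (linf_norm (\<lambda>s. norm (u s)))"
  have nn: "0 \<le> ?x" "0 \<le> ?y"
    using gain_nonneg[OF gain_B] gain_nonneg[OF gain_G] linf_norm_nonneg by auto
  have "\<phi> (?x + ?y) \<le> \<phi> (2 * ?x) + \<phi> (2 * ?y)"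
  proof (cases "?x \<le> ?y")
    case True
    then have "\<phi> (?x + ?y) \<le> \<phi> (2 * ?y)" using nn by (intro gain_mono[OF \<phi>_gain]) auto
    moreover have "0 \<le> \<phi> (2 * ?x)" using nn by (intro gain_nonneg[OF \<phi>_gain]) auto
    ultimately show ?thesis by simp
  next
    case False
    then have "\<phi> (?x + ?y) \<le> \<phi> (2 * ?x)" using nn by (intro gain_mono[OF \<phi>_gain]) auto
    moreover have "0 \<le> \<phi> (2 * ?y)" using nn by (intro gain_nonneg[OF \<phi>_gain]) auto
    ultimately show ?thesis by simp
  qed
  then have "real n * \<phi> (?x + ?y) \<le> \<sigma> (norm (z 0)) + \<psi> (linf_norm (\<lambda>s. norm (u s)))"
    unfolding \<sigma>_def \<psi>_def by (simp add: distrib_left[symmetric] mult_left_mono)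
  with interval_norm_bound[OF assms(1) solves_on_imp_upto[OF assms(2)], of t t] assms(3)
  show ?thesis by simp
qed

text \<open>The time \<open>T\<close> must not depend on the input norm \<open>U\<close>: for \<open>U \<le> r\<close> a finite grid of norms
  suffices, and for \<open>U > r\<close> the summand \<open>\<sigma> U\<close> already dominates the influence of the initial value.\<close>
lemma uniform_attraction:
  assumes r: "0 \<le> r" and \<epsilon>: "0 < \<epsilon>"
  shows "\<exists>T\<ge>0. \<forall>z u t. is_Linf u \<and> solves_on f UNIV z u \<and> norm (z 0) \<le> r \<and> T \<le> t \<longrightarrow>
    norm (z t) \<le> \<psi> (linf_norm (\<lambda>s. norm (u s))) + \<sigma> (linf_norm (\<lambda>s. norm (u s))) + \<epsilon>"
proof -
  have "continuous_on {0..} \<psi>" using gain_\<psi> by (simp add: gain_def)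
  then have "continuous_on {0..r + 1} \<psi>" by (rule continuous_on_subset) auto
  then have "uniformly_continuous_on {0..r + 1} \<psi>"
    by (rule compact_uniformly_continuous) auto
  then obtain \<delta> where \<delta>: "0 < \<delta>" "\<And>x y. x \<in> {0..r+1} \<Longrightarrow> y \<in> {0..r+1} \<Longrightarrow> dist y x < \<delta> \<Longrightarrow> dist (\<psi> y) (\<psi> x) < \<epsilon> / 2"
    using \<epsilon> unfolding uniformly_continuous_on_def by (metis half_gt_zero)
  \<comment> \<open>Rounding an input norm \<open>U \<le> r\<close> up to the grid adds less than
    \<open>h\<close>, so the grid point lies within \<open>\<delta>\<close> of \<open>U\<close> and,
    as \<open>h \<le> 1\<close>, inside \<open>[0, r + 1]\<close>.\<close>
  define h where "h = min (\<delta> / 2) 1"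
  have h: "0 < h" "h < \<delta>" "h \<le> 1" using \<delta>(1) by (auto simp: h_def)
  \<comment> \<open>The errors of the \<open>n\<close> blocks add up to at most
    \<open>\<epsilon> / 2\<close>; the other half pays for rounding the input norm.\<close>
  define \<epsilon>' where "\<epsilon>' = \<epsilon> / (2 * (real n + 1))"
  have \<epsilon>': "0 < \<epsilon>'" "real n * \<epsilon>' \<le> \<epsilon> / 2" using \<epsilon> by (auto simp: \<epsilon>'_def field_simps)
  have "\<forall>k::nat. \<exists>T\<ge>0. \<forall>z u t i. is_Linf u \<and> solves_on f UNIV z u \<and> norm (z 0) \<le> r \<and>
    linf_norm (\<lambda>s. norm (u s)) \<le> real k * h \<and> T \<le> t \<and> i < n \<longrightarrow>
      norm (bproj blk i (z t)) \<le> \<phi> (G (real k * h)) + \<epsilon>'"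
    using h by (intro allI block_attraction r \<epsilon>') auto
  then obtain T where T0: "\<And>k::nat. 0 \<le> T k" and T: "\<And>k z u t i. is_Linf u \<Longrightarrow> solves_on f UNIV z u \<Longrightarrow>
      norm (z 0) \<le> r \<Longrightarrow> linf_norm (\<lambda>s. norm (u s)) \<le> real k * h \<Longrightarrow> T k \<le> t \<Longrightarrow> i < n \<Longrightarrow>
      norm (bproj blk i (z t)) \<le> \<phi> (G (real k * h)) + \<epsilon>'"
    by metis
  \<comment> \<open>Norms up to \<open>r\<close> round to grid indices at most \<open>K\<close>. The
    sum of the nonnegative times \<open>T k\<close> over these indices dominates each of them and
    serves as the common time.\<close>
  define K where "K = nat \<lceil>r / h\<rceil>"
  have "norm (z t) \<le> \<psi> (linf_norm (\<lambda>s. norm (u s))) + \<sigma> (linf_norm (\<lambda>s. norm (u s))) + \<epsilon>"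
    if u: "is_Linf u" and z: "solves_on f UNIV z u" "norm (z 0) \<le> r" and t: "(\<Sum>k\<le>K. T k) \<le> t" for z u t
  proof -
    define U where "U = linf_norm (\<lambda>s. norm (u s))"
    have U: "0 \<le> U" unfolding U_def by (rule linf_norm_nonneg) simp
    have t0: "0 \<le> t" using t sum_nonneg[of "{..K}" T] T0 by simp
    have \<sigma>U: "0 \<le> \<sigma> U" by (rule gain_nonneg[OF gain_\<sigma> U])
    show ?thesis
    proof (cases "U \<le> r")
      case True
      define k where "k = nat \<lceil>U / h\<rceil>"
      have kU: "real k = of_int \<lceil>U / h\<rceil>" using U h by (simp add: k_def)
      have "U / h \<le> real k" "real k < U / h + 1" unfolding kU by linarith+
      then have k: "U \<le> real k * h" "real k * h < U + h" using h by (auto simp: field_simps)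
      have "k \<le> K" unfolding k_def K_def using True h
        by (intro nat_mono ceiling_mono divide_right_mono) auto
      then have "T k \<le> (\<Sum>k\<le>K. T k)" using T0 by (intro member_le_sum) auto
      then have "T k \<le> t" using t by simp
      then have "(\<Sum>i<n. norm (bproj blk i (z t))) \<le> (\<Sum>i<n. \<phi> (G (real k * h)) + \<epsilon>')"
        using u z k(1) by (intro sum_mono T) (auto simp: U_def)
      then have "norm (z t) \<le> real n * \<phi> (G (real k * h)) + real n * \<epsilon>'"
        using norm_le_sum_bproj[OF blocks, of "z t"] by (simp add: distrib_left)
      also have "real n * \<phi> (G (real k * h)) \<le> \<psi> (real k * h)"
        unfolding \<psi>_def using gain_nonneg[OF gain_G, of "real k * h"] h
        by (intro mult_left_mono gain_mono[OF \<phi>_gain]) auto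
      also have "\<psi> (real k * h) \<le> \<psi> U + \<epsilon> / 2"
      proof -
        have "dist (\<psi> (real k * h)) (\<psi> U) < \<epsilon> / 2"
          using U True k h by (intro \<delta>(2)) (auto simp: dist_real_def)
        then show ?thesis unfolding dist_real_def by linarith
      qed
      finally show ?thesis using \<epsilon>' \<sigma>U unfolding U_def by simp
    next
      case False
      have "\<sigma> (norm (z 0)) \<le> \<sigma> U" using False z by (intro gain_mono[OF gain_\<sigma>]) auto
      with global_bound[OF u z(1) t0] \<epsilon> show ?thesis unfolding U_def by simp
    qed
  qed
  moreover have "0 \<le> (\<Sum>k\<le>K. T k)" by (intro sum_nonneg T0)
  ultimately show ?thesis by blast
qed

text \<open>Subtracting the input gain from the norm before taking suprema leaves a function of
  initial size and time alone. It is monotone in both by construction, bounded by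
  \<open>\<sigma>\<close>, and decays by uniform attraction, which is what
  \<open>KL_majorant\<close> asks for.\<close>

theorem interconnection_ISS:
  "\<exists>\<beta>' \<gamma>'. classKL \<beta>' \<and> classK \<gamma>' \<and>
     (\<forall>\<xi> u. is_Linf u \<longrightarrow> (\<exists>z. z 0 = \<xi> \<and> solves_on f UNIV z u)) \<and>
     (\<forall>z u. is_Linf u \<and> solves_on f UNIV z u \<longrightarrow>
        (\<forall>t\<ge>0. norm (z t) \<le> \<beta>' (norm (z 0)) t + \<gamma>' (linf_norm (\<lambda>s. norm (u s)))))"
proof -
  \<comment> \<open>\<open>\<psi>\<close> is the input part of the global bound,
    \<open>\<sigma>\<close> accounts for inputs larger than the initial value in the attraction
    estimate, and the identity makes the sum strictly increasing.\<close>
  define \<gamma>' where "\<gamma>' r = (\<psi> r + \<sigma> r) + r" for r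
  have \<gamma>': "classK \<gamma>'"
    unfolding \<gamma>'_def by (intro classK_gain_plus_id gain_add gain_\<psi> gain_\<sigma>)
  have \<gamma>'_ge: "\<psi> r + \<sigma> r \<le> \<gamma>' r" "\<psi> r \<le> \<gamma>' r" if "0 \<le> r" for r
    using gain_nonneg[OF gain_\<sigma> that] that by (auto simp: \<gamma>'_def)
  have Un: "0 \<le> linf_norm (\<lambda>s. norm (u s))" for u :: "real \<Rightarrow> real^'m" by (rule linf_norm_nonneg) simp
  \<comment> \<open>The excess over the input gain may be negative; inserting 0 makes the supremum
    nonnegative.\<close>
  define S where "S s t = insert 0 {norm (z q) - \<gamma>' (linf_norm (\<lambda>s. norm (u s))) | z u q.
      is_Linf u \<and> solves_on f UNIV z u \<and> norm (z 0) \<le> s \<and> t \<le> q}" for s t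
  define b where "b s t = Sup (S s t)" for s t
  have S_le: "x \<le> \<sigma> s" if "x \<in> S s t" "0 \<le> s" "0 \<le> t" for x s t
  proof -
    consider "x = 0" | z u q where "is_Linf u" "solves_on f UNIV z u" "norm (z 0) \<le> s" "t \<le> q"
      "x = norm (z q) - \<gamma>' (linf_norm (\<lambda>s. norm (u s)))"
      using \<open>x \<in> S s t\<close> unfolding S_def by blast
    then show ?thesis
    proof cases
      case 1
      then show ?thesis using gain_nonneg[OF gain_\<sigma> \<open>0 \<le> s\<close>] by simp
    next
      case 2
      have "norm (z q) \<le> \<sigma> (norm (z 0)) + \<psi> (linf_norm (\<lambda>s. norm (u s)))"
        using 2 that by (intro global_bound) auto
      moreover have "\<sigma> (norm (z 0)) \<le> \<sigma> s" using 2 by (intro gain_mono[OF gain_\<sigma>]) auto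
      ultimately show ?thesis using \<gamma>'_ge(2)[OF Un, of u] 2 by simp
    qed
  qed
  have S_bdd: "bdd_above (S s t)" if "0 \<le> s" "0 \<le> t" for s t
    using S_le that by (meson bdd_aboveI)
  have S_ne: "S s t \<noteq> {}" for s t by (simp add: S_def)
  have "\<exists>\<beta>'. classKL \<beta>' \<and> (\<forall>s\<ge>0. \<forall>t\<ge>0. b s t \<le> \<beta>' s t)"
  proof (rule KL_majorant[where \<sigma>=\<sigma>])
    show "0 \<le> b s t" if "0 \<le> s" "0 \<le> t" for s t
      unfolding b_def using that by (intro cSup_upper S_bdd) (simp add: S_def)
    show "b s t \<le> b s' t" if "0 \<le> s" "s \<le> s'" "0 \<le> t" for s s' t
      unfolding b_def using that
      by (intro cSup_subset_mono S_ne S_bdd) (auto simp: S_def intro: order_trans)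
    show "b s t' \<le> b s t" if "0 \<le> s" "0 \<le> t" "t \<le> t'" for s t t'
      unfolding b_def using that
      by (intro cSup_subset_mono S_ne S_bdd) (auto simp: S_def intro: order_trans)
    show "b s t \<le> \<sigma> s" if "0 \<le> s" "0 \<le> t" for s t
      unfolding b_def using S_le that by (intro cSup_least S_ne) auto
    show "(b s \<longlongrightarrow> 0) at_top" if s: "0 \<le> s" for s
    proof (rule tendstoI)
      fix e :: real assume e: "0 < e"
      obtain T where T: "0 \<le> T" "\<And>z u t. is_Linf u \<Longrightarrow> solves_on f UNIV z u \<Longrightarrow> norm (z 0) \<le> s \<Longrightarrow> T \<le> t \<Longrightarrow>
          norm (z t) \<le> \<psi> (linf_norm (\<lambda>s. norm (u s))) + \<sigma> (linf_norm (\<lambda>s. norm (u s))) + e / 2"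
        using uniform_attraction[OF s, of "e / 2"] e by auto
      show "\<forall>\<^sub>F t in at_top. dist (b s t) 0 < e"
        using eventually_ge_at_top[of T]
      proof eventually_elim
        case (elim t)
        have "b s t \<le> e / 2"
          unfolding b_def
        proof (intro cSup_least S_ne)
          fix x assume "x \<in> S s t"
          then consider "x = 0" | z u q where "is_Linf u" "solves_on f UNIV z u" "norm (z 0) \<le> s" "t \<le> q"
            "x = norm (z q) - \<gamma>' (linf_norm (\<lambda>s. norm (u s)))"
            unfolding S_def by blast
          then show "x \<le> e / 2"
          proof cases
            case 2
            then show ?thesis using T(2)[of u z q] \<gamma>'_ge(1)[OF Un, of u] elim by simp
          qed (use e in simp)
        qed
        moreover have "0 \<le> b s t"
          unfolding b_def using s T(1) elim by (intro cSup_upper S_bdd) (simp_all add: S_def)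
        ultimately show ?case using e by simp
      qed
    qed
  qed (rule gain_\<sigma>)
  then obtain \<beta>' where \<beta>': "classKL \<beta>'" "\<And>s t. 0 \<le> s \<Longrightarrow> 0 \<le> t \<Longrightarrow> b s t \<le> \<beta>' s t" by blast
  have "norm (z t) \<le> \<beta>' (norm (z 0)) t + \<gamma>' (linf_norm (\<lambda>s. norm (u s)))"
    if "is_Linf u" "solves_on f UNIV z u" "0 \<le> t" for z u t
  proof -
    have "norm (z t) - \<gamma>' (linf_norm (\<lambda>s. norm (u s))) \<le> b (norm (z 0)) t"
      unfolding b_def using that by (intro cSup_upper S_bdd) (auto simp: S_def)
    with \<beta>'(2)[of "norm (z 0)" t] that show ?thesis by simp
  qed
  with \<beta>'(1) \<gamma>' global_solution_exists show ?thesis by blast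
qed

end

theorem theorem3:
  fixes f :: "real^'d \<Rightarrow> real^'m \<Rightarrow> real^'d"
    and blk :: "'d \<Rightarrow> nat" and ublk :: "'m \<Rightarrow> nat"
    and n :: nat and Isig Imax :: "nat set"
    and \<beta> :: "nat \<Rightarrow> real \<Rightarrow> real \<Rightarrow> real"
    and \<gamma> :: "nat \<Rightarrow> nat \<Rightarrow> real \<Rightarrow> real"
    and \<gamma>u :: "nat \<Rightarrow> real \<Rightarrow> real"
  assumes blocks: "blk ` UNIV = {..<n}"
    and ublocks: "ublk ` UNIV \<subseteq> {..<n}"
    and f_cont: "continuous_on UNIV (\<lambda>(x, u). f x u)"
    and f_lip: "\<forall>r. \<forall>x0. \<exists>\<delta>>0. \<exists>L. \<forall>x\<in>ball x0 \<delta>. \<forall>y\<in>ball x0 \<delta>. \<forall>u.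
                  norm u \<le> r \<longrightarrow> norm (f x u - f y u) \<le> L * dist x y"
    and f_input: "\<forall>x u v k. (\<forall>l. ublk l = blk k \<longrightarrow> u $ l = v $ l) \<longrightarrow> f x u $ k = f x v $ k"
    and partition: "Isig \<union> Imax = {..<n}" "Isig \<inter> Imax = {}"
    and \<beta>_KL: "\<forall>i<n. classKL (\<beta> i)"
    and \<gamma>_gain: "\<forall>i<n. \<forall>j<n. classKinf0 (\<gamma> i j)"
    and \<gamma>_diag: "\<forall>i<n. \<forall>s\<ge>0. \<gamma> i i s = 0"
    and \<gamma>u_gain: "\<forall>i<n. classKinf0 (\<gamma>u i)"
    and sub_exists: "\<forall>i<n. \<forall>\<xi> w u. is_Linf u \<and> (\<forall>j<n. j \<noteq> i \<longrightarrow> is_Linf (\<lambda>t. bproj blk j (w t))) \<longrightarrow>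
        (\<exists>z. (\<forall>t\<ge>0. \<forall>k. blk k \<noteq> i \<longrightarrow> z t $ k = w t $ k) \<and>
             bproj blk i (z 0) = bproj blk i \<xi> \<and> solves_on f {k. blk k = i} z u)"
    and sub_ISS_sum: "\<forall>i\<in>Isig. \<forall>z u. is_Linf u \<and> (\<forall>j<n. j \<noteq> i \<longrightarrow> is_Linf (\<lambda>t. bproj blk j (z t)))
        \<and> solves_on f {k. blk k = i} z u \<longrightarrow>
        (\<forall>t\<ge>0. norm (bproj blk i (z t)) \<le>
            \<beta> i (norm (bproj blk i (z 0))) t
          + (\<Sum>j<n. \<gamma> i j (linf_norm (trunc t (\<lambda>s. norm (bproj blk j (z s))))))
          + \<gamma>u i (linf_norm (\<lambda>s. norm (u s))))"
    and sub_ISS_max: "\<forall>i\<in>Imax. \<forall>z u. is_Linf u \<and> (\<forall>j<n. j \<noteq> i \<longrightarrow> is_Linf (\<lambda>t. bproj blk j (z t)))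
        \<and> solves_on f {k. blk k = i} z u \<longrightarrow>
        (\<forall>t\<ge>0. norm (bproj blk i (z t)) \<le>
            max (\<beta> i (norm (bproj blk i (z 0))) t)
             (max (Max ((\<lambda>j. \<gamma> i j (linf_norm (trunc t (\<lambda>s. norm (bproj blk j (z s)))))) ` {..<n}))
                  (\<gamma>u i (linf_norm (\<lambda>s. norm (u s))))))"
    and small_gain: "\<exists>\<alpha>. classKinf \<alpha> \<and>
        (\<forall>s :: nat \<Rightarrow> real. (\<forall>i<n. 0 \<le> s i) \<and> (\<exists>i<n. s i \<noteq> 0) \<longrightarrow>
           (\<exists>i<n. Gamma_op n Isig \<gamma> (D_op Isig \<alpha> s) i < s i))"
  shows "\<exists>\<beta>' \<gamma>'. classKL \<beta>' \<and> classK \<gamma>' \<and>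
     (\<forall>\<xi> u. is_Linf u \<longrightarrow> (\<exists>z. z 0 = \<xi> \<and> solves_on f UNIV z u)) \<and>
     (\<forall>z u. is_Linf u \<and> solves_on f UNIV z u \<longrightarrow>
        (\<forall>t\<ge>0. norm (z t) \<le> \<beta>' (norm (z 0)) t + \<gamma>' (linf_norm (\<lambda>s. norm (u s)))))"
proof -
  have \<gamma>: "gain (\<gamma> i j)" if "i < n" "j < n" for i j
    using \<gamma>_gain that by (blast intro: classKinf0_gain)
  obtain \<alpha> where \<alpha>: "classKinf \<alpha>"
    and sg: "\<forall>s. (\<forall>i<n. 0 \<le> s i) \<and> (\<exists>i<n. s i \<noteq> 0) \<longrightarrow>
      (\<exists>i<n. Gamma_op n Isig \<gamma> (D_op Isig \<alpha> s) i < s i)"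
    using small_gain by blast
  obtain \<phi> where "gain \<phi>" and cmp: "\<forall>b w. 0 \<le> b \<and>
      (\<forall>i<n. 0 \<le> w i \<and> w i \<le> mixed_op n Isig \<gamma> b w i) \<longrightarrow> (\<forall>i<n. w i \<le> \<phi> b)"
    using small_gain_comparison[OF \<alpha> \<gamma> sg] by blast
  interpret small_gain_interconnection f blk n Isig Imax \<beta> \<gamma> \<gamma>u \<phi>
  proof
    show "classKL (\<beta> i)" if "i < n" for i using \<beta>_KL that by blast
    show "gain (\<gamma>u i)" if "i < n" for i using \<gamma>u_gain that by (blast intro: classKinf0_gain)
    show "w i \<le> \<phi> b" if "0 \<le> b" "\<And>j. j < n \<Longrightarrow> 0 \<le> w j"
      "\<And>j. j < n \<Longrightarrow> w j \<le> mixed_op n Isig \<gamma> b w j" "i < n" for b w i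
      using cmp that by blast
  qed (fact blocks f_cont f_lip partition(1) \<gamma> sub_exists sub_ISS_sum sub_ISS_max \<open>gain \<phi>\<close>)+
  show ?thesis by (rule interconnection_ISS)
qed

end
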